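(* Let $1\le p<\infty$ and let $d_{w,p}$ be a Lorentz sequence space. If $T\in J^j$ and $T$ is not compact, then $J^j\subseteq J_T$.
   Context: Let $1\le p<\infty$ and let $w=(w_n)$ be a real sequence with $w_1=1$, $w_n\downarrow 0$ and $\sum_n w_n=\infty$. The Lorentz sequence space $d_{w,p}$ is the Banach space of all $x=(x_n)\in c_0$ with $\|x\|_{d_{w,p}}=\big(\sum_{n}w_n (x^*_n)^p\big)^{1/p}<\infty$, where $(x^*_n)$ is the non-increasing rearrangement of $(|x_n|)$. Let $(e_n)$, $(f_n)$ be the unit vector bases of $d_{w,p}$, $\ell_p$, and $j\colon\ell_p\to d_{w,p}$ the formal identity, $j(f_n)=e_n$. $J^j$ is the set of $S\in L(d_{w,p})$ of the form $S=AjB$ with $A\in L(d_{w,p})$, $B\in L(d_{w,p},\ell_p)$. $J_T=\{\sum_{i=1}^n A_iTB_i: n\in\mathbb N, A_i,B_i\in L(d_{w,p})\}$ is the ideal generated by $T$. *)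

theory Defs
  imports Complex_Main
begin

text \<open>Real sequences are functions nat => real (index 0 corresponds to index 1 of the paper).
  Operators are functions between sequence spaces; they are only meaningful on their domain,
  so all equalities of operators are required on the domain only.\<close>

text \<open>Non-increasing rearrangement: rearr x n = inf over sets F with at most n elements of
  sup of |x k| for k outside F (the (n+1)-th largest value of |x|).\<close>
definition rearr :: "(nat \<Rightarrow> real) \<Rightarrow> nat \<Rightarrow> real" where
  "rearr x n = Inf {Sup ((\<lambda>k. \<bar>x k\<bar>) ` (UNIV - F)) | F. finite F \<and> card F \<le> n}"

definition lorentz_norm :: "(nat \<Rightarrow> real) \<Rightarrow> real \<Rightarrow> (nat \<Rightarrow> real) \<Rightarrow> real" where
  "lorentz_norm w p x = (\<Sum>n. w n * (rearr x n) powr p) powr (1 / p)"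

definition lorentz_space :: "(nat \<Rightarrow> real) \<Rightarrow> real \<Rightarrow> (nat \<Rightarrow> real) set" where
  "lorentz_space w p = {x. x \<longlonglongrightarrow> 0 \<and> summable (\<lambda>n. w n * (rearr x n) powr p)}"

definition lp_norm :: "real \<Rightarrow> (nat \<Rightarrow> real) \<Rightarrow> real" where
  "lp_norm p x = (\<Sum>n. \<bar>x n\<bar> powr p) powr (1 / p)"

definition lp_space :: "real \<Rightarrow> (nat \<Rightarrow> real) set" where
  "lp_space p = {x. summable (\<lambda>n. \<bar>x n\<bar> powr p)}"

definition bounded_op ::
  "(nat \<Rightarrow> real) set \<Rightarrow> ((nat \<Rightarrow> real) \<Rightarrow> real) \<Rightarrow> (nat \<Rightarrow> real) set \<Rightarrow> ((nat \<Rightarrow> real) \<Rightarrow> real)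
    \<Rightarrow> ((nat \<Rightarrow> real) \<Rightarrow> (nat \<Rightarrow> real)) \<Rightarrow> bool" where
  "bounded_op X nX Y nY T \<longleftrightarrow>
     (\<forall>x\<in>X. T x \<in> Y) \<and>
     (\<forall>x\<in>X. \<forall>y\<in>X. T (\<lambda>n. x n + y n) = (\<lambda>n. T x n + T y n)) \<and>
     (\<forall>x\<in>X. \<forall>c. T (\<lambda>n. c * x n) = (\<lambda>n. c * T x n)) \<and>
     (\<exists>C. \<forall>x\<in>X. nY (T x) \<le> C * nX x)"

definition Lop_d :: "(nat \<Rightarrow> real) \<Rightarrow> real \<Rightarrow> ((nat \<Rightarrow> real) \<Rightarrow> (nat \<Rightarrow> real)) set" where
  "Lop_d w p = {T. bounded_op (lorentz_space w p) (lorentz_norm w p)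
                              (lorentz_space w p) (lorentz_norm w p) T}"

definition Lop_d_lp :: "(nat \<Rightarrow> real) \<Rightarrow> real \<Rightarrow> ((nat \<Rightarrow> real) \<Rightarrow> (nat \<Rightarrow> real)) set" where
  "Lop_d_lp w p = {T. bounded_op (lorentz_space w p) (lorentz_norm w p)
                                 (lp_space p) (lp_norm p) T}"

definition compact_op_d :: "(nat \<Rightarrow> real) \<Rightarrow> real \<Rightarrow> ((nat \<Rightarrow> real) \<Rightarrow> (nat \<Rightarrow> real)) \<Rightarrow> bool" where
  "compact_op_d w p T \<longleftrightarrow>
     (\<forall>xs. (\<forall>k. xs k \<in> lorentz_space w p) \<and> (\<exists>M::real. \<forall>k::nat. lorentz_norm w p (xs k) \<le> M) \<longrightarrow>
        (\<exists>(r::nat \<Rightarrow> nat) y. strict_mono r \<and> y \<in> lorentz_space w p \<and>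
           (\<lambda>k. lorentz_norm w p (\<lambda>n. T (xs (r k)) n - y n)) \<longlonglongrightarrow> 0))"

text \<open>J^j: operators S = A j B with j the formal identity l_p -> d_{w,p}.\<close>
definition Jj :: "(nat \<Rightarrow> real) \<Rightarrow> real \<Rightarrow> ((nat \<Rightarrow> real) \<Rightarrow> (nat \<Rightarrow> real)) set" where
  "Jj w p = {S. S \<in> Lop_d w p \<and>
     (\<exists>A B. A \<in> Lop_d w p \<and> B \<in> Lop_d_lp w p \<and>
        (\<forall>x\<in>lorentz_space w p. S x = A (id (B x))))}"

definition JT :: "(nat \<Rightarrow> real) \<Rightarrow> real \<Rightarrow> ((nat \<Rightarrow> real) \<Rightarrow> (nat \<Rightarrow> real))
     \<Rightarrow> ((nat \<Rightarrow> real) \<Rightarrow> (nat \<Rightarrow> real)) set" where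
  "JT w p T = {S. \<exists>(m::nat) A B. (\<forall>i<m. A i \<in> Lop_d w p \<and> B i \<in> Lop_d w p) \<and>
     (\<forall>x\<in>lorentz_space w p. S x = (\<lambda>n. \<Sum>i<m. A i (T (B i x)) n))}"

end

(*
  Write T = A j B.  Since T is not compact, a subsequence argument gives a bounded sequence (u k) with
  u k, B (u k) and T (u k) coordinatewise null and T (u k) bounded away from 0.  If the sup norms of
  T (u k) tended to 0, then along a gliding-hump subsequence the sum of n terms T (u k) would have
  norm^p at least a multiple of n, while j maps the corresponding sums of the B (u k) to vectors of
  norm^p o(n), because their coordinates stay bounded; A bounded makes this a contradiction.  So along
  a subsequence T (u k) has a large coordinate m k.  Passing to almost disjoint u k and T (u k),
  U f_k = u k is bounded from l_p because disjoint vectors satisfy an upper p-estimate, and reading off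
  the coordinates m k, suitably scaled, turns T U into j plus a small perturbation, which is inverted
  by a fixed point iteration on bounded sequences.  Thus R T U = j for some R, and every A' j B' equals
  (A' R) T (U B').
*)
theory Submission
  imports Defs "HOL-Complex_Analysis.Great_Picard"
begin

section \<open>The modulus of a Lorentz sequence space\<close>

text \<open>All estimates are for p-th powers of norms, with (a + b)^p \<le> 2^p (a^p + b^p) in the
  role of the triangle inequality. Its constant multiplies up in long sums, so the errors left by
  the gliding humps are made to decay faster than (2^p)^-k. The large coordinates of
  \<open>T (u k)\<close> matter because reading off distinct coordinates is bounded on a space with
  a symmetric basis. They yield a left inverse although disjoint vectors satisfy only an upper
  p-estimate: \<open>R T U\<close> is the identity as a map from l_p into the Lorentz space, which
  is j. The perturbed identity is inverted among bounded sequences, where its kernel is a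
  contraction. The solution returns to the Lorentz space because the errors, being so small, sum
  there with any bounded coefficients. The limit w -> 0 enters through interpolation between the sup
  norm and l_p: it makes the modulus of a sum of n almost disjoint vectors o(n).\<close>

text \<open>\<open>mod_le w p x M\<close> says that the \<open>p\<close>-th power of the Lorentz norm of \<open>x\<close> is at most \<open>M\<close>, phrased
  without the decreasing rearrangement.  The weight constantly \<open>1\<close> gives \<open>\<ell>\<^sub>p\<close>.\<close>
definition mod_le :: "(nat \<Rightarrow> real) \<Rightarrow> real \<Rightarrow> (nat \<Rightarrow> real) \<Rightarrow> real \<Rightarrow> bool" where
  "mod_le w p x M \<longleftrightarrow>
     (\<forall>F \<sigma>. finite F \<longrightarrow> inj_on \<sigma> F \<longrightarrow> (\<Sum>i\<in>F. w (\<sigma> i) * \<bar>x i\<bar> powr p) \<le> M)"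

definition restr :: "nat set \<Rightarrow> (nat \<Rightarrow> real) \<Rightarrow> nat \<Rightarrow> real" where
  "restr I x = (\<lambda>i. if i \<in> I then x i else 0)"

definition disjoint_supports :: "(nat \<Rightarrow> nat \<Rightarrow> real) \<Rightarrow> bool" where
  "disjoint_supports v \<longleftrightarrow> (\<forall>i k l. v k i \<noteq> 0 \<longrightarrow> v l i \<noteq> 0 \<longrightarrow> k = l)"

lemma mod_leD:
  "mod_le w p x M \<Longrightarrow> finite F \<Longrightarrow> inj_on \<sigma> F \<Longrightarrow> (\<Sum>i\<in>F. w (\<sigma> i) * \<bar>x i\<bar> powr p) \<le> M"
  by (auto simp: mod_le_def)

lemma mod_leI:
  "(\<And>F \<sigma>. finite F \<Longrightarrow> inj_on \<sigma> F \<Longrightarrow> (\<Sum>i\<in>F. w (\<sigma> i) * \<bar>x i\<bar> powr p) \<le> M) \<Longrightarrow> mod_le w p x M"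
  by (auto simp: mod_le_def)

lemma mod_le_weaken: "mod_le w p x M \<Longrightarrow> M \<le> M' \<Longrightarrow> mod_le w p x M'"
  unfolding mod_le_def by (meson order_trans)

lemma disjoint_supports_sum_cases:
  assumes "disjoint_supports v"
  obtains "(\<Sum>k<n. v k i) = 0" | k where "k < n" "(\<Sum>k<n. v k i) = v k i"
proof (cases "\<exists>k<n. v k i \<noteq> 0")
  case True
  then obtain k where k: "k < n" "v k i \<noteq> 0" by auto
  have "(\<Sum>l<n. v l i) = (\<Sum>l\<in>{k}. v l i)"
    using k assms by (intro sum.mono_neutral_right) (auto simp: disjoint_supports_def)
  with k that(2) show ?thesis by auto
next
  case False
  with that(1) show ?thesis by auto
qed

lemma powr_add_le:
  fixes a b p :: real
  assumes "0 \<le> a" "0 \<le> b" "0 \<le> p"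
  shows "(a + b) powr p \<le> 2 powr p * (a powr p + b powr p)"
proof -
  have "(a + b) powr p \<le> (2 * max a b) powr p"
    using assms by (intro powr_mono2) auto
  also have "\<dots> = 2 powr p * max a b powr p"
    using assms by (simp add: powr_mult)
  also have "\<dots> \<le> 2 powr p * (a powr p + b powr p)"
    by (intro mult_left_mono) (auto simp: max_def)
  finally show ?thesis .
qed

text \<open>Weak enough to admit the constant weight 1, so that every lemma about moduli serves l_p
  as well; the limit w -> 0 is assumed separately where it matters.\<close>

locale lorentz_weight =
  fixes w :: "nat \<Rightarrow> real" and p :: real
  assumes p_ge_1: "1 \<le> p"
    and w_0: "w 0 = 1"
    and w_nonneg: "0 \<le> w n"
    and w_antimono: "antimono w"
    and w_not_summable: "\<not> summable w"
begin

lemma p_pos: "0 < p"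
  using p_ge_1 by simp

lemma w_le_1: "w n \<le> 1"
  using w_antimono w_0 by (metis antimonoD le0)

lemma mod_le_nonneg: "mod_le w p x M \<Longrightarrow> 0 \<le> M"
  using mod_leD[of w p x M "{}"] by simp

lemma mod_le_mono:
  assumes "mod_le w p y M" "\<And>i. \<bar>x i\<bar> \<le> \<bar>y i\<bar>" "M \<le> M'"
  shows "mod_le w p x M'"
proof (rule mod_leI)
  fix F :: "nat set" and \<sigma> :: "nat \<Rightarrow> nat"
  assume F: "finite F" "inj_on \<sigma> F"
  have "(\<Sum>i\<in>F. w (\<sigma> i) * \<bar>x i\<bar> powr p) \<le> (\<Sum>i\<in>F. w (\<sigma> i) * \<bar>y i\<bar> powr p)"
    using assms(2) p_pos w_nonneg by (intro sum_mono mult_left_mono powr_mono2) auto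
  also have "\<dots> \<le> M'"
    using mod_leD[OF assms(1) F] assms(3) by simp
  finally show "(\<Sum>i\<in>F. w (\<sigma> i) * \<bar>x i\<bar> powr p) \<le> M'" .
qed

lemma mod_le_add:
  assumes "mod_le w p x M" "mod_le w p y M'"
  shows "mod_le w p (\<lambda>i. x i + y i) (2 powr p * (M + M'))"
proof (rule mod_leI)
  fix F :: "nat set" and \<sigma> :: "nat \<Rightarrow> nat"
  assume F: "finite F" "inj_on \<sigma> F"
  have "(\<Sum>i\<in>F. w (\<sigma> i) * \<bar>x i + y i\<bar> powr p)
      \<le> (\<Sum>i\<in>F. w (\<sigma> i) * (2 powr p * (\<bar>x i\<bar> powr p + \<bar>y i\<bar> powr p)))"
  proof (intro sum_mono mult_left_mono w_nonneg)
    fix i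
    have "\<bar>x i + y i\<bar> powr p \<le> (\<bar>x i\<bar> + \<bar>y i\<bar>) powr p"
      using p_pos by (intro powr_mono2) auto
    also have "\<dots> \<le> 2 powr p * (\<bar>x i\<bar> powr p + \<bar>y i\<bar> powr p)"
      using p_pos by (intro powr_add_le) auto
    finally show "\<bar>x i + y i\<bar> powr p \<le> 2 powr p * (\<bar>x i\<bar> powr p + \<bar>y i\<bar> powr p)" .
  qed
  also have "\<dots> = 2 powr p * ((\<Sum>i\<in>F. w (\<sigma> i) * \<bar>x i\<bar> powr p) + (\<Sum>i\<in>F. w (\<sigma> i) * \<bar>y i\<bar> powr p))"
    by (simp add: sum_distrib_left sum.distrib algebra_simps)
  also have "\<dots> \<le> 2 powr p * (M + M')"
    using mod_leD[OF assms(1) F] mod_leD[OF assms(2) F] by (intro mult_left_mono add_mono) auto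
  finally show "(\<Sum>i\<in>F. w (\<sigma> i) * \<bar>x i + y i\<bar> powr p) \<le> 2 powr p * (M + M')" .
qed

lemma mod_le_scale:
  assumes "mod_le w p x M"
  shows "mod_le w p (\<lambda>i. c * x i) (\<bar>c\<bar> powr p * M)"
proof (rule mod_leI)
  fix F :: "nat set" and \<sigma> :: "nat \<Rightarrow> nat"
  assume F: "finite F" "inj_on \<sigma> F"
  have "(\<Sum>i\<in>F. w (\<sigma> i) * \<bar>c * x i\<bar> powr p) = \<bar>c\<bar> powr p * (\<Sum>i\<in>F. w (\<sigma> i) * \<bar>x i\<bar> powr p)"
    by (simp add: sum_distrib_left abs_mult powr_mult algebra_simps)
  also have "\<dots> \<le> \<bar>c\<bar> powr p * M"
    using mod_leD[OF assms F] by (intro mult_left_mono) auto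
  finally show "(\<Sum>i\<in>F. w (\<sigma> i) * \<bar>c * x i\<bar> powr p) \<le> \<bar>c\<bar> powr p * M" .
qed

lemma mod_le_zero: "mod_le w p (\<lambda>i. 0) 0"
  using p_pos by (intro mod_leI) auto

lemma mod_le_uminus: "mod_le w p x M \<Longrightarrow> mod_le w p (\<lambda>i. - x i) M"
  by (erule mod_le_mono) auto

lemma mod_le_diff:
  assumes "mod_le w p x M" "mod_le w p y M'"
  shows "mod_le w p (\<lambda>i. x i - y i) (2 powr p * (M + M'))"
  using mod_le_add[OF assms(1) mod_le_uminus[OF assms(2)]] by simp

lemma mod_le_powr_point:
  assumes "mod_le w p x M"
  shows "\<bar>x i\<bar> powr p \<le> M"
  using mod_leD[OF assms, of "{i}" "\<lambda>_. 0"] by (simp add: w_0)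

lemma mod_le_point:
  assumes "mod_le w p x M"
  shows "\<bar>x i\<bar> \<le> M powr (1/p)"
proof -
  have "(\<bar>x i\<bar> powr p) powr (1/p) \<le> M powr (1/p)"
    using mod_le_powr_point[OF assms] p_pos by (intro powr_mono2) auto
  thus ?thesis using p_pos by (simp add: powr_powr)
qed

text \<open>Peeling off the first summand, not the last, ties the accumulated constant to the
  position \<open>k\<close> instead of the length \<open>n\<close>; sequences
  \<open>\<epsilon>\<close> that decay fast enough then give a bound uniform in
  \<open>n\<close>.\<close>

lemma mod_le_sum_quasi:
  assumes "\<And>k. k < n \<Longrightarrow> mod_le w p (t k) (\<epsilon> k)"
  shows "mod_le w p (\<lambda>i. \<Sum>k<n. t k i) (\<Sum>k<n. (2 powr p) ^ Suc k * \<epsilon> k)"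
  using assms
proof (induction n arbitrary: t \<epsilon>)
  case 0
  show ?case by (simp add: mod_le_zero)
next
  case (Suc n)
  have "mod_le w p (\<lambda>i. \<Sum>k<n. t (Suc k) i) (\<Sum>k<n. (2 powr p) ^ Suc k * \<epsilon> (Suc k))"
    using Suc.prems by (intro Suc.IH) auto
  from mod_le_add[OF Suc.prems[of 0] this]
  show ?case
    by (subst (1 2) sum.lessThan_Suc_shift) (simp add: sum_distrib_left algebra_simps)
qed

text \<open>The upper p-estimate, with constant 1: at each coordinate at most one summand is
  nonzero, and one assignment \<open>\<sigma>\<close> of weights serves all summands at
  once.\<close>

lemma mod_le_sum_disjoint:
  assumes v: "disjoint_supports v" and M: "\<And>k. k < n \<Longrightarrow> mod_le w p (v k) (M k)"
  shows "mod_le w p (\<lambda>i. \<Sum>k<n. v k i) (\<Sum>k<n. M k)"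
proof (rule mod_leI)
  fix F :: "nat set" and \<sigma> :: "nat \<Rightarrow> nat"
  assume F: "finite F" "inj_on \<sigma> F"
  have *: "\<bar>\<Sum>k<n. v k i\<bar> powr p \<le> (\<Sum>k<n. \<bar>v k i\<bar> powr p)" for i
  proof (cases rule: disjoint_supports_sum_cases[OF v, where n = n and i = i])
    case 1
    thus ?thesis using p_pos by (simp add: sum_nonneg)
  next
    case (2 k)
    thus ?thesis by (auto intro!: member_le_sum)
  qed
  have "(\<Sum>i\<in>F. w (\<sigma> i) * \<bar>\<Sum>k<n. v k i\<bar> powr p) \<le> (\<Sum>i\<in>F. w (\<sigma> i) * (\<Sum>k<n. \<bar>v k i\<bar> powr p))"
    by (intro sum_mono mult_left_mono * w_nonneg)
  also have "\<dots> = (\<Sum>k<n. \<Sum>i\<in>F. w (\<sigma> i) * \<bar>v k i\<bar> powr p)"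
    by (subst sum.swap) (simp add: sum_distrib_left)
  also have "\<dots> \<le> (\<Sum>k<n. M k)"
    using M F by (intro sum_mono) (auto dest: mod_leD)
  finally show "(\<Sum>i\<in>F. w (\<sigma> i) * \<bar>\<Sum>k<n. v k i\<bar> powr p) \<le> (\<Sum>k<n. M k)" .
qed

text \<open>A Fatou property: each sum in the modulus sees only finitely many coordinates. It
  replaces norm convergence when infinite sums and coordinatewise limits are formed.\<close>

lemma mod_le_limit:
  assumes "\<And>n. mod_le w p (x n) M" "\<And>i. (\<lambda>n. x n i) \<longlonglongrightarrow> y i"
  shows "mod_le w p y M"
proof (rule mod_leI)
  fix F :: "nat set" and \<sigma> :: "nat \<Rightarrow> nat"
  assume F: "finite F" "inj_on \<sigma> F"
  have "(\<lambda>n. \<Sum>i\<in>F. w (\<sigma> i) * \<bar>x n i\<bar> powr p) \<longlonglongrightarrow> (\<Sum>i\<in>F. w (\<sigma> i) * \<bar>y i\<bar> powr p)"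
    using p_pos by (intro tendsto_sum tendsto_mult tendsto_const tendsto_powr' tendsto_rabs assms) auto
  thus "(\<Sum>i\<in>F. w (\<sigma> i) * \<bar>y i\<bar> powr p) \<le> M"
    by (rule LIMSEQ_le_const2) (use mod_leD[OF assms(1) F] in auto)
qed

text \<open>Symmetry of the unit vector basis: an assignment for the selected coordinates is
  transported along the inverse of \<open>m\<close>.\<close>

lemma mod_le_comp:
  assumes "mod_le w p x M" "inj m"
  shows "mod_le w p (\<lambda>k. x (m k)) M"
proof (rule mod_leI)
  fix F :: "nat set" and \<sigma> :: "nat \<Rightarrow> nat"
  assume F: "finite F" "inj_on \<sigma> F"
  have m: "inj_on m F" using assms(2) by (rule inj_on_subset) auto
  have "(\<Sum>i\<in>m ` F. w (\<sigma> (inv m i)) * \<bar>x i\<bar> powr p) \<le> M"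
    using F assms(2) by (intro mod_leD[OF assms(1)]) (auto simp: inj_on_def)
  thus "(\<Sum>i\<in>F. w (\<sigma> i) * \<bar>x (m i)\<bar> powr p) \<le> M"
    using assms(2) by (simp add: sum.reindex[OF m])
qed

text \<open>Infinitely many coordinates of size at least \<open>\<eta>\<close> could be given the
  weights \<open>w 0\<close>, \<open>w 1\<close>, ..., which would bound the partial sums of the
  divergent series of weights.\<close>

lemma mod_le_tendsto_0:
  assumes "mod_le w p x M"
  shows "x \<longlonglongrightarrow> 0"
proof (rule ccontr)
  assume "\<not> x \<longlonglongrightarrow> 0"
  then obtain \<eta> where \<eta>: "\<eta> > 0" "\<forall>N. \<exists>n\<ge>N. \<bar>x n\<bar> \<ge> \<eta>"
    by (auto simp: LIMSEQ_iff not_less)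
  hence "infinite {n. \<bar>x n\<bar> \<ge> \<eta>}"
    by (auto simp: infinite_nat_iff_unbounded_le)
  then obtain e :: "nat \<Rightarrow> nat" where e: "inj e" "range e \<subseteq> {n. \<bar>x n\<bar> \<ge> \<eta>}"
    using infinite_countable_subset by blast
  have bound: "(\<Sum>k<n. w k) \<le> M / \<eta> powr p" for n
  proof -
    have "(\<Sum>k<n. w k * \<eta> powr p) \<le> (\<Sum>k<n. w (id k) * \<bar>x (e k)\<bar> powr p)"
      using e \<eta> p_pos by (intro sum_mono) (auto intro!: mult_left_mono powr_mono2 w_nonneg)
    also have "\<dots> \<le> M"
      by (intro mod_leD[OF mod_le_comp[OF assms e(1)]]) auto
    finally have "(\<Sum>k<n. w k) * \<eta> powr p \<le> M" by (simp add: sum_distrib_right)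
    thus ?thesis using \<eta> by (simp add: field_simps)
  qed
  have "summable w"
    by (rule bounded_imp_summable[of _ "M / \<eta> powr p"])
       (use w_nonneg bound[of "Suc _"] in \<open>auto simp only: lessThan_Suc_atMost\<close>)
  with w_not_summable show False by contradiction
qed

section \<open>Heads and tails, and interpolation between the sup norm and l_p\<close>

lemma mod_le_restr: "mod_le w p x M \<Longrightarrow> mod_le w p (restr I x) M"
  by (erule mod_le_mono) (auto simp: restr_def)

lemma mod_le_fin_support:
  assumes "\<And>i. i \<ge> a \<Longrightarrow> x i = 0"
  shows "mod_le w p x (\<Sum>i<a. \<bar>x i\<bar> powr p)"
proof (rule mod_leI)
  fix F :: "nat set" and \<sigma> :: "nat \<Rightarrow> nat"
  assume F: "finite F" "inj_on \<sigma> F"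
  have "(\<Sum>i\<in>F. w (\<sigma> i) * \<bar>x i\<bar> powr p) \<le> (\<Sum>i\<in>F. \<bar>x i\<bar> powr p)"
    by (intro sum_mono mult_left_le_one_le) (auto simp: w_nonneg w_le_1)
  also have "\<dots> = (\<Sum>i\<in>F \<inter> {..<a}. \<bar>x i\<bar> powr p)"
    using F p_pos assms by (intro sum.mono_neutral_right) (auto simp: not_less[symmetric])
  also have "\<dots> \<le> (\<Sum>i<a. \<bar>x i\<bar> powr p)"
    by (intro sum_mono2) auto
  finally show "(\<Sum>i\<in>F. w (\<sigma> i) * \<bar>x i\<bar> powr p) \<le> (\<Sum>i<a. \<bar>x i\<bar> powr p)" .
qed

lemma eventually_mod_le_head:
  assumes "\<And>i. (\<lambda>k. x k i) \<longlonglongrightarrow> 0" "\<epsilon> > 0"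
  shows "\<forall>\<^sub>F k in sequentially. mod_le w p (restr {..<a} (x k)) \<epsilon>"
proof -
  have "(\<lambda>k. \<Sum>i<a. \<bar>x k i\<bar> powr p) \<longlonglongrightarrow> (\<Sum>i<a. \<bar>0\<bar> powr p)"
    using p_pos by (intro tendsto_sum tendsto_powr' tendsto_rabs assms tendsto_const) auto
  hence "\<forall>\<^sub>F k in sequentially. (\<Sum>i<a. \<bar>x k i\<bar> powr p) < \<epsilon>"
    using assms(2) p_pos by (intro order_tendstoD) auto
  thus ?thesis
  proof eventually_elim
    case (elim k)
    have "mod_le w p (restr {..<a} (x k)) (\<Sum>i<a. \<bar>restr {..<a} (x k) i\<bar> powr p)"
      by (intro mod_le_fin_support) (auto simp: restr_def)
    thus ?case using elim by (elim mod_le_weaken) (auto simp: restr_def)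
  qed
qed

text \<open>If all tails were large, a far-out part of a tail could be adjoined to a near-extremal
  finite sum for \<open>x\<close>; the indices whose weights are already used cost little because \<open>x\<close> tends
  to \<open>0\<close>.\<close>
lemma eventually_mod_le_tail:
  assumes x: "mod_le w p x M" and \<epsilon>: "\<epsilon> > 0"
  shows "\<forall>\<^sub>F a in sequentially. mod_le w p (restr {a..} x) \<epsilon>"
proof -
  define S where "S = {(\<Sum>i\<in>F. w (\<sigma> i) * \<bar>x i\<bar> powr p) | F \<sigma>. finite F \<and> inj_on \<sigma> F}"
  have bdd: "bdd_above S"
    using mod_leD[OF x] by (intro bdd_aboveI[of _ M]) (auto simp: S_def)
  have "S \<noteq> {}" by (auto simp: S_def)
  then obtain s where s: "s \<in> S" "Sup S - \<epsilon> / 2 < s"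
    using less_cSup_iff[OF _ bdd, of "Sup S - \<epsilon>/2"] \<epsilon> by auto
  then obtain F \<sigma> where F: "finite F" "inj_on \<sigma> F" "s = (\<Sum>i\<in>F. w (\<sigma> i) * \<bar>x i\<bar> powr p)"
    by (auto simp: S_def)
  have "(\<lambda>i. \<bar>x i\<bar> powr p) \<longlonglongrightarrow> \<bar>0\<bar> powr p"
    using p_pos by (intro tendsto_powr' tendsto_rabs mod_le_tendsto_0[OF x] tendsto_const) auto
  hence "\<forall>\<^sub>F i in sequentially. \<bar>x i\<bar> powr p < \<epsilon> / (2 * (card F + 1))"
    using \<epsilon> p_pos by (intro order_tendstoD) auto
  then obtain a0 where a0: "\<And>i. i \<ge> a0 \<Longrightarrow> \<bar>x i\<bar> powr p < \<epsilon> / (2 * (card F + 1))"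
    by (auto simp: eventually_at_top_linorder)
  obtain a1 where a1: "\<And>i. i \<in> F \<Longrightarrow> i < a1"
    using F(1) unfolding finite_nat_set_iff_bounded by auto
  show ?thesis unfolding eventually_at_top_linorder
  proof (intro exI allI impI mod_leI)
    fix a and G :: "nat set" and \<tau> :: "nat \<Rightarrow> nat"
    assume a: "max a0 a1 \<le> a" and G: "finite G" "inj_on \<tau> G"
    define G1 where "G1 = {i\<in>G. i \<ge> a \<and> \<tau> i \<in> \<sigma> ` F}"
    define G2 where "G2 = {i\<in>G. i \<ge> a \<and> \<tau> i \<notin> \<sigma> ` F}"
    have fin: "finite G1" "finite G2" using G by (auto simp: G1_def G2_def)
    have FG: "F \<inter> G2 = {}"
    proof -
      have "i < a" if "i \<in> F" for i using a1[OF that] a by simp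
      thus ?thesis by (fastforce simp: G2_def)
    qed
    define \<rho> where "\<rho> = (\<lambda>i. if i \<in> F then \<sigma> i else \<tau> i)"
    have "inj_on \<rho> (F \<union> G2)"
      unfolding \<rho>_def
    proof (rule inj_on_disjoint_Un)
      show "inj_on \<sigma> F" by (rule F(2))
      show "inj_on \<tau> G2" using G(2) by (rule inj_on_subset) (auto simp: G2_def)
      show "\<sigma> ` F \<inter> \<tau> ` G2 = {}" by (auto simp: G2_def) (metis image_eqI)
    qed
    hence "(\<Sum>i\<in>F \<union> G2. w (\<rho> i) * \<bar>x i\<bar> powr p) \<in> S"
      using F(1) fin by (auto simp: S_def)
    hence "(\<Sum>i\<in>F \<union> G2. w (\<rho> i) * \<bar>x i\<bar> powr p) \<le> Sup S"
      by (intro cSup_upper bdd)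
    also have "(\<Sum>i\<in>F \<union> G2. w (\<rho> i) * \<bar>x i\<bar> powr p)
        = (\<Sum>i\<in>F. w (\<rho> i) * \<bar>x i\<bar> powr p) + (\<Sum>i\<in>G2. w (\<rho> i) * \<bar>x i\<bar> powr p)"
      using F(1) fin FG by (intro sum.union_disjoint) auto
    also have "(\<Sum>i\<in>F. w (\<rho> i) * \<bar>x i\<bar> powr p) = s"
      by (simp add: F(3) \<rho>_def)
    also have "(\<Sum>i\<in>G2. w (\<rho> i) * \<bar>x i\<bar> powr p) = (\<Sum>i\<in>G2. w (\<tau> i) * \<bar>x i\<bar> powr p)"
      using FG by (intro sum.cong) (auto simp: \<rho>_def)
    finally have 2: "(\<Sum>i\<in>G2. w (\<tau> i) * \<bar>x i\<bar> powr p) \<le> \<epsilon> / 2"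
      using s(2) by simp
    have "card (\<tau> ` G1) \<le> card (\<sigma> ` F)"
      using F(1) by (intro card_mono) (auto simp: G1_def)
    also have "\<dots> \<le> card F" using F(1) by (rule card_image_le)
    also have "card (\<tau> ` G1) = card G1"
      using G(2) by (intro card_image) (auto simp: inj_on_def G1_def)
    finally have card: "card G1 \<le> card F" .
    have "(\<Sum>i\<in>G1. w (\<tau> i) * \<bar>x i\<bar> powr p) \<le> (\<Sum>i\<in>G1. 1 * (\<epsilon> / (2 * (card F + 1))))"
      using a a0 by (intro sum_mono mult_mono w_le_1) (fastforce simp: G1_def intro: less_imp_le)+
    also have "\<dots> = card G1 * (\<epsilon> / (2 * (card F + 1)))" by simp
    also have "\<dots> \<le> (card F + 1) * (\<epsilon> / (2 * (card F + 1)))"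
      using card \<epsilon> by (intro mult_right_mono) auto
    also have "\<dots> = \<epsilon> / 2" by (simp add: field_simps)
    finally have 1: "(\<Sum>i\<in>G1. w (\<tau> i) * \<bar>x i\<bar> powr p) \<le> \<epsilon> / 2" .
    have "(\<Sum>i\<in>G. w (\<tau> i) * \<bar>restr {a..} x i\<bar> powr p) = (\<Sum>i\<in>G1 \<union> G2. w (\<tau> i) * \<bar>restr {a..} x i\<bar> powr p)"
      using G p_pos by (intro sum.mono_neutral_right) (auto simp: restr_def G1_def G2_def)
    also have "\<dots> = (\<Sum>i\<in>G1 \<union> G2. w (\<tau> i) * \<bar>x i\<bar> powr p)"
      by (intro sum.cong) (auto simp: restr_def G1_def G2_def)
    also have "\<dots> = (\<Sum>i\<in>G1. w (\<tau> i) * \<bar>x i\<bar> powr p) + (\<Sum>i\<in>G2. w (\<tau> i) * \<bar>x i\<bar> powr p)"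
      using fin by (intro sum.union_disjoint) (auto simp: G1_def G2_def)
    also have "\<dots> \<le> \<epsilon>" using 1 2 by simp
    finally show "(\<Sum>i\<in>G. w (\<tau> i) * \<bar>restr {a..} x i\<bar> powr p) \<le> \<epsilon>" .
  qed
qed

text \<open>At most \<open>L\<close> indices carry a weight larger than \<open>w L\<close>.\<close>
lemma mod_le_interpolate:
  assumes x: "mod_le (\<lambda>_. 1) p x Q" and s: "\<And>i. \<bar>x i\<bar> powr p \<le> s"
  shows "mod_le w p x (L * s + w L * Q)"
proof (rule mod_leI)
  fix F :: "nat set" and \<sigma> :: "nat \<Rightarrow> nat"
  assume F: "finite F" "inj_on \<sigma> F"
  define G where "G = {i\<in>F. \<sigma> i < L}"
  have s0: "0 \<le> s" using s[of 0] powr_ge_zero[of "\<bar>x 0\<bar>" p] by linarith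
  have G: "finite G" "G \<subseteq> F" using F by (auto simp: G_def)
  have "card (\<sigma> ` G) \<le> card {..<L}" by (intro card_mono) (auto simp: G_def)
  moreover have "card (\<sigma> ` G) = card G"
    using F(2) by (intro card_image) (auto simp: inj_on_def G_def)
  ultimately have card: "card G \<le> L" by simp
  have "(\<Sum>i\<in>G. w (\<sigma> i) * \<bar>x i\<bar> powr p) \<le> (\<Sum>i\<in>G. 1 * s)"
    using s by (intro sum_mono mult_mono w_le_1) auto
  also have "\<dots> = card G * s" by simp
  also have "\<dots> \<le> L * s"
    using card s0 by (intro mult_right_mono) auto
  finally have 1: "(\<Sum>i\<in>G. w (\<sigma> i) * \<bar>x i\<bar> powr p) \<le> L * s" .
  have "(\<Sum>i\<in>F - G. w (\<sigma> i) * \<bar>x i\<bar> powr p) \<le> (\<Sum>i\<in>F - G. w L * (1 * \<bar>x i\<bar> powr p))"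
    unfolding mult_1
    using w_antimono by (intro sum_mono mult_right_mono) (auto simp: G_def antimono_def)
  also have "\<dots> = w L * (\<Sum>i\<in>F - G. 1 * \<bar>x i\<bar> powr p)"
    by (simp only: sum_distrib_left)
  also have "\<dots> \<le> w L * Q"
    using mod_leD[OF x, of "F - G" id] F by (intro mult_left_mono w_nonneg) auto
  finally have 2: "(\<Sum>i\<in>F - G. w (\<sigma> i) * \<bar>x i\<bar> powr p) \<le> w L * Q" .
  show "(\<Sum>i\<in>F. w (\<sigma> i) * \<bar>x i\<bar> powr p) \<le> L * s + w L * Q"
    using 1 2 sum.subset_diff[OF G(2) F(1), of "\<lambda>i. w (\<sigma> i) * \<bar>x i\<bar> powr p"] by simp
qed

end

lemma lorentz_weight_one: "1 \<le> p \<Longrightarrow> lorentz_weight (\<lambda>_. 1) p"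
  by unfold_locales (auto simp: antimono_def summable_const_iff)

section \<open>Non-increasing rearrangements\<close>

lemma tendsto_0_bdd_above_abs:
  fixes x :: "nat \<Rightarrow> real"
  assumes "x \<longlonglongrightarrow> 0"
  shows "bdd_above ((\<lambda>k. \<bar>x k\<bar>) ` A)"
proof -
  have "Bseq x" using assms by (intro convergent_imp_Bseq convergentI)
  then obtain K where "\<And>n. \<bar>x n\<bar> \<le> K" by (auto simp: Bseq_def)
  thus ?thesis by (intro bdd_aboveI2[of _ _ K])
qed

text \<open>The greedy choice behind \<open>rearr_le_injection\<close>: a supremum outside a finite
  set is attained, since only finitely many values reach a given positive one.\<close>

lemma tendsto_0_max_outside_finite:
  fixes x :: "nat \<Rightarrow> real"
  assumes "x \<longlonglongrightarrow> 0" "finite F"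
  obtains i where "i \<notin> F" "\<And>k. k \<notin> F \<Longrightarrow> \<bar>x k\<bar> \<le> \<bar>x i\<bar>"
proof (cases "\<forall>k. k \<notin> F \<longrightarrow> x k = 0")
  case True
  obtain i where "i \<notin> F" using ex_new_if_finite[OF infinite_UNIV_nat assms(2)] by auto
  with True that show ?thesis by auto
next
  case False
  then obtain k0 where k0: "k0 \<notin> F" "\<bar>x k0\<bar> > 0" by auto
  define K where "K = {k. k \<notin> F \<and> \<bar>x k\<bar> \<ge> \<bar>x k0\<bar>}"
  have "\<forall>\<^sub>F k in sequentially. \<bar>x k\<bar> < \<bar>x k0\<bar>"
    using tendsto_rabs[OF assms(1)] k0 by (intro order_tendstoD) auto
  then obtain N where N: "\<And>k. k \<ge> N \<Longrightarrow> \<bar>x k\<bar> < \<bar>x k0\<bar>"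
    by (auto simp: eventually_at_top_linorder)
  have "K \<subseteq> {..<N}"
  proof
    fix k assume "k \<in> K"
    thus "k \<in> {..<N}" using N[of k] by (cases "k < N") (auto simp: K_def)
  qed
  hence "finite K" by (rule finite_subset) auto
  moreover have "k0 \<in> K" using k0 by (auto simp: K_def)
  ultimately have "Max ((\<lambda>k. \<bar>x k\<bar>) ` K) \<in> (\<lambda>k. \<bar>x k\<bar>) ` K"
    by (intro Max_in) auto
  then obtain i where i: "i \<in> K" "Max ((\<lambda>k. \<bar>x k\<bar>) ` K) = \<bar>x i\<bar>" by auto
  have max: "\<bar>x k\<bar> \<le> \<bar>x i\<bar>" if "k \<in> K" for k
    using Max_ge[of "(\<lambda>k. \<bar>x k\<bar>) ` K" "\<bar>x k\<bar>"] that i(2) \<open>finite K\<close> by auto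
  show ?thesis
  proof (rule that)
    show "i \<notin> F" using i by (simp add: K_def)
    show "\<bar>x k\<bar> \<le> \<bar>x i\<bar>" if "k \<notin> F" for k
      using max[of k] max[OF \<open>k0 \<in> K\<close>] that
      by (cases "\<bar>x k0\<bar> \<le> \<bar>x k\<bar>") (auto simp: K_def)
  qed
qed

lemma Sup_outside_finite_nonneg:
  fixes x :: "nat \<Rightarrow> real"
  assumes "x \<longlonglongrightarrow> 0" "finite F"
  shows "0 \<le> Sup ((\<lambda>k. \<bar>x k\<bar>) ` (UNIV - F))"
proof -
  obtain i where "i \<notin> F" using ex_new_if_finite[OF infinite_UNIV_nat assms(2)] by auto
  thus ?thesis
    by (intro cSup_upper2[of "\<bar>x i\<bar>"] tendsto_0_bdd_above_abs[OF assms(1)]) auto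
qed

lemma rearr_nonneg:
  assumes "x \<longlonglongrightarrow> 0"
  shows "0 \<le> rearr x n"
  unfolding rearr_def
proof (rule cInf_greatest)
  show "{Sup ((\<lambda>k. \<bar>x k\<bar>) ` (UNIV - F)) |F. finite F \<and> card F \<le> n} \<noteq> {}"
    by (auto intro!: exI[of _ "{}"])
qed (auto intro!: Sup_outside_finite_nonneg assms)

lemma rearr_le:
  assumes x: "x \<longlonglongrightarrow> 0" and F: "finite F" "card F \<le> n"
    and i: "i \<notin> F" "\<And>k. k \<notin> F \<Longrightarrow> \<bar>x k\<bar> \<le> \<bar>x i\<bar>"
  shows "rearr x n \<le> \<bar>x i\<bar>"
proof -
  have "Sup ((\<lambda>k. \<bar>x k\<bar>) ` (UNIV - F)) = \<bar>x i\<bar>"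
    using i by (intro cSup_eq_maximum) auto
  moreover have "bdd_below {Sup ((\<lambda>k. \<bar>x k\<bar>) ` (UNIV - F)) |F. finite F \<and> card F \<le> n}"
    using Sup_outside_finite_nonneg[OF x] by (intro bdd_belowI[of _ 0]) auto
  ultimately show ?thesis
    unfolding rearr_def using F by (intro cInf_lower) (metis (mono_tags, lifting) mem_Collect_eq)
qed

lemma le_rearr:
  assumes x: "x \<longlonglongrightarrow> 0" and F: "finite F" "n < card F" "\<And>i. i \<in> F \<Longrightarrow> c \<le> \<bar>x i\<bar>"
  shows "c \<le> rearr x n"
  unfolding rearr_def
proof (rule cInf_greatest)
  show "{Sup ((\<lambda>k. \<bar>x k\<bar>) ` (UNIV - F)) |F. finite F \<and> card F \<le> n} \<noteq> {}"
    by (auto intro!: exI[of _ "{}"])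
next
  fix s assume "s \<in> {Sup ((\<lambda>k. \<bar>x k\<bar>) ` (UNIV - F)) |F. finite F \<and> card F \<le> n}"
  then obtain G where G: "finite G" "card G \<le> n" "s = Sup ((\<lambda>k. \<bar>x k\<bar>) ` (UNIV - G))" by auto
  have "\<not> F \<subseteq> G" using card_mono[OF G(1), of F] G(2) F(2) by auto
  then obtain i where i: "i \<in> F" "i \<notin> G" by auto
  show "c \<le> s"
    unfolding G(3) using i F(3)
    by (intro cSup_upper2[of "\<bar>x i\<bar>"] tendsto_0_bdd_above_abs[OF x]) auto
qed

text \<open>Greedy selection: the next index maximizes \<bar>x\<bar> outside those already chosen,
  and the chosen ones are an admissible removed set in the definition of
  \<open>rearr\<close>.\<close>

lemma rearr_le_injection:
  assumes x: "x \<longlonglongrightarrow> 0"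
  obtains \<iota> :: "nat \<Rightarrow> nat" where "inj_on \<iota> {..<K}" "\<And>n. n < K \<Longrightarrow> rearr x n \<le> \<bar>x (\<iota> n)\<bar>"
proof -
  have "\<exists>\<iota> :: nat \<Rightarrow> nat. inj_on \<iota> {..<K} \<and> (\<forall>n<K. rearr x n \<le> \<bar>x (\<iota> n)\<bar>)"
  proof (induction K)
    case 0
    show ?case by auto
  next
    case (Suc K)
    then obtain \<iota> :: "nat \<Rightarrow> nat"
      where \<iota>: "inj_on \<iota> {..<K}" "\<And>n. n < K \<Longrightarrow> rearr x n \<le> \<bar>x (\<iota> n)\<bar>" by auto
    obtain i where i: "i \<notin> \<iota> ` {..<K}" "\<And>k. k \<notin> \<iota> ` {..<K} \<Longrightarrow> \<bar>x k\<bar> \<le> \<bar>x i\<bar>"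
      using tendsto_0_max_outside_finite[OF x, of "\<iota> ` {..<K}"] by auto
    have "rearr x K \<le> \<bar>x i\<bar>"
      using i card_image_le[of "{..<K}" \<iota>] by (intro rearr_le[OF x, of "\<iota> ` {..<K}"]) auto
    with \<iota> i(1) show ?case
      by (intro exI[of _ "\<iota>(K := i)"]) (auto simp: lessThan_Suc less_Suc_eq inj_on_def)
  qed
  with that show ?thesis by auto
qed

text \<open>The smallest value is moved to the largest index by exchanging two indices, and then
  split off.\<close>
lemma sum_rearrangement_le:
  fixes w b c :: "nat \<Rightarrow> real"
  assumes w: "antimono w" "\<And>n. 0 \<le> w n"
    and "finite F" "inj_on \<sigma> F"
    and "\<And>G \<beta>. G \<subseteq> F \<Longrightarrow> G \<noteq> {} \<Longrightarrow> (\<And>i. i \<in> G \<Longrightarrow> \<beta> \<le> b i) \<Longrightarrow> \<beta> \<le> c (card G - 1)"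
    and "\<And>i. i \<in> F \<Longrightarrow> 0 \<le> b i"
  shows "(\<Sum>i\<in>F. w (\<sigma> i) * b i) \<le> (\<Sum>n<card F. w n * c n)"
  using assms(3-)
proof (induction "card F" arbitrary: F \<sigma>)
  case 0
  thus ?case by simp
next
  case (Suc m)
  note c = Suc.prems(3)
  have fin: "finite F" and inj: "inj_on \<sigma> F" and "F \<noteq> {}" using Suc.prems Suc.hyps(2) by auto
  obtain i0 where i0: "i0 \<in> F" "\<And>i. i \<in> F \<Longrightarrow> b i0 \<le> b i"
    using arg_min_if_finite(1)[OF fin \<open>F \<noteq> {}\<close>, of b] arg_min_least[OF fin \<open>F \<noteq> {}\<close>, of _ b]
    by blast
  have "Max (\<sigma> ` F) \<in> \<sigma> ` F" using fin \<open>F \<noteq> {}\<close> by (intro Max_in) auto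
  then obtain i1 where i1: "i1 \<in> F" "Max (\<sigma> ` F) = \<sigma> i1" by auto
  have i1_max: "\<sigma> i \<le> \<sigma> i1" if "i \<in> F" for i
    unfolding i1(2)[symmetric] using fin that by auto
  define \<sigma>' where "\<sigma>' = \<sigma>(i1 := \<sigma> i0)"
  define F' where "F' = F - {i0}"
  have fin': "finite F'" using fin by (simp add: F'_def)
  have card': "m = card F'" using Suc.hyps(2) i0 fin by (simp add: F'_def)
  have inj': "inj_on \<sigma>' F'"
    using inj i0 i1 by (auto simp: inj_on_def \<sigma>'_def F'_def)
  have IH: "(\<Sum>i\<in>F'. w (\<sigma>' i) * b i) \<le> (\<Sum>n<card F'. w n * c n)"
    using Suc.prems by (intro Suc.hyps(1) card' fin' inj') (auto simp: F'_def)
  have split: "(\<Sum>i\<in>F. w (\<sigma> i) * b i) = w (\<sigma> i0) * b i0 + (\<Sum>i\<in>F'. w (\<sigma> i) * b i)"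
    using fin i0 by (simp add: F'_def sum.remove)
  have swap: "(\<Sum>i\<in>F. w (\<sigma> i) * b i) \<le> w (\<sigma> i1) * b i0 + (\<Sum>i\<in>F'. w (\<sigma>' i) * b i)"
  proof (cases "i0 = i1")
    case True
    thus ?thesis unfolding split by (simp add: \<sigma>'_def F'_def)
  next
    case False
    hence i1': "i1 \<in> F'" using i1 by (simp add: F'_def)
    have 1: "(\<Sum>i\<in>F'. w (\<sigma> i) * b i) = w (\<sigma> i1) * b i1 + (\<Sum>i\<in>F' - {i1}. w (\<sigma> i) * b i)"
      by (rule sum.remove[OF fin' i1'])
    have 2: "(\<Sum>i\<in>F'. w (\<sigma>' i) * b i) = w (\<sigma> i0) * b i1 + (\<Sum>i\<in>F' - {i1}. w (\<sigma> i) * b i)"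
      by (subst sum.remove[OF fin' i1']) (auto simp: \<sigma>'_def intro!: sum.cong)
    have "w (\<sigma> i1) \<le> w (\<sigma> i0)" using i1_max[OF i0(1)] w(1) by (auto simp: antimono_def)
    hence "0 \<le> (w (\<sigma> i0) - w (\<sigma> i1)) * (b i1 - b i0)"
      using i0(2)[OF i1(1)] by (intro mult_nonneg_nonneg) auto
    thus ?thesis unfolding split 1 2 by (simp add: algebra_simps)
  qed
  \<comment> \<open>The m + 1 distinct values of \<open>\<sigma>\<close> on \<open>F\<close> are all
    at most \<open>\<sigma> i1\<close>, so the largest of them is at least m.\<close>
  have "card (\<sigma> ` F) \<le> card {..\<sigma> i1}" using i1_max by (intro card_mono) auto
  hence "m \<le> \<sigma> i1" using card_image[OF inj] Suc.hyps(2) by simp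
  hence "w (\<sigma> i1) * b i0 \<le> w m * b i0"
    using w Suc.prems(4) i0 by (intro mult_right_mono) (auto simp: antimono_def)
  also have "b i0 \<le> c (card F - 1)" using i0 \<open>F \<noteq> {}\<close> by (intro c) auto
  hence "w m * b i0 \<le> w m * c m"
    using Suc.hyps(2) w by (intro mult_left_mono) (metis diff_Suc_1, auto)
  finally have "w (\<sigma> i1) * b i0 \<le> w m * c m" .
  thus ?case
    unfolding Suc.hyps(2)[symmetric] sum.lessThan_Suc using swap IH[folded card'] by linarith
qed

context lorentz_weight
begin

lemma lorentz_norm_powr:
  assumes "x \<longlonglongrightarrow> 0" "summable (\<lambda>n. w n * rearr x n powr p)"
  shows "lorentz_norm w p x powr p = (\<Sum>n. w n * rearr x n powr p)"
proof -
  have "0 \<le> (\<Sum>n. w n * rearr x n powr p)"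
    using assms(2) w_nonneg by (intro suminf_nonneg) auto
  thus ?thesis using p_pos by (simp add: lorentz_norm_def powr_powr)
qed

text \<open>By the rearrangement inequality no assignment of weights beats pairing large entries
  with large weights. Together with the converse estimate below, the p-th power of the norm is the
  least \<open>M\<close> with \<open>mod_le w p x M\<close>.\<close>

lemma mod_le_lorentz_norm:
  assumes "x \<in> lorentz_space w p"
  shows "mod_le w p x (lorentz_norm w p x powr p)"
proof (rule mod_leI)
  fix F :: "nat set" and \<sigma> :: "nat \<Rightarrow> nat"
  assume F: "finite F" "inj_on \<sigma> F"
  have x: "x \<longlonglongrightarrow> 0" "summable (\<lambda>n. w n * rearr x n powr p)"
    using assms by (auto simp: lorentz_space_def)
  have "(\<Sum>i\<in>F. w (\<sigma> i) * \<bar>x i\<bar> powr p) \<le> (\<Sum>n<card F. w n * rearr x n powr p)"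
  proof (rule sum_rearrangement_le[OF w_antimono w_nonneg F])
    fix G \<beta> assume G: "G \<subseteq> F" "G \<noteq> {}" and \<beta>: "\<And>i. i \<in> G \<Longrightarrow> \<beta> \<le> \<bar>x i\<bar> powr p"
    have fin: "finite G" using G(1) F(1) by (rule finite_subset)
    have "card G > 0" using fin G(2) by (simp add: card_gt_0_iff)
    define g where "g = Min ((\<lambda>i. \<bar>x i\<bar>) ` G)"
    have "g \<in> (\<lambda>i. \<bar>x i\<bar>) ` G" unfolding g_def using fin G(2) by (intro Min_in) auto
    then obtain i where i: "i \<in> G" "g = \<bar>x i\<bar>" by auto
    have "g \<le> rearr x (card G - 1)"
      using fin \<open>card G > 0\<close> by (intro le_rearr[OF x(1) fin]) (auto simp: g_def)
    hence "g powr p \<le> rearr x (card G - 1) powr p"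
      using i p_pos by (intro powr_mono2) auto
    with \<beta>[OF i(1)] i(2) show "\<beta> \<le> rearr x (card G - 1) powr p" by simp
  qed auto
  also have "\<dots> \<le> (\<Sum>n. w n * rearr x n powr p)"
    using x w_nonneg by (intro sum_le_suminf) auto
  also have "\<dots> = lorentz_norm w p x powr p" using lorentz_norm_powr[OF x] ..
  finally show "(\<Sum>i\<in>F. w (\<sigma> i) * \<bar>x i\<bar> powr p) \<le> lorentz_norm w p x powr p" .
qed

text \<open>The inverse of the greedy injection is an admissible \<open>\<sigma>\<close>, so every
  partial sum of the rearranged series is dominated by a sum occurring in the modulus.\<close>

lemma
  assumes x: "mod_le w p x M"
  shows mod_le_in_lorentz_space: "x \<in> lorentz_space w p"
    and lorentz_norm_powr_le: "lorentz_norm w p x powr p \<le> M"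
proof -
  have lim: "x \<longlonglongrightarrow> 0" by (rule mod_le_tendsto_0[OF x])
  have le: "(\<Sum>n<K. w n * rearr x n powr p) \<le> M" for K
  proof -
    obtain \<iota> :: "nat \<Rightarrow> nat"
      where \<iota>: "inj_on \<iota> {..<K}" "\<And>n. n < K \<Longrightarrow> rearr x n \<le> \<bar>x (\<iota> n)\<bar>"
      using rearr_le_injection[OF lim] by blast
    have "(\<Sum>n<K. w n * rearr x n powr p) \<le> (\<Sum>n<K. w n * \<bar>x (\<iota> n)\<bar> powr p)"
      using \<iota>(2) p_pos
      by (intro sum_mono mult_left_mono w_nonneg powr_mono2) (auto intro: rearr_nonneg lim)
    also have "\<dots> = (\<Sum>n<K. w (inv_into {..<K} \<iota> (\<iota> n)) * \<bar>x (\<iota> n)\<bar> powr p)"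
      using \<iota>(1) by (intro sum.cong) auto
    also have "\<dots> = (\<Sum>i\<in>\<iota> ` {..<K}. w (inv_into {..<K} \<iota> i) * \<bar>x i\<bar> powr p)"
      by (subst sum.reindex[OF \<iota>(1)]) simp
    also have "\<dots> \<le> M"
      using \<iota>(1) by (intro mod_leD[OF x] inj_on_inv_into) auto
    finally show ?thesis .
  qed
  have sum: "summable (\<lambda>n. w n * rearr x n powr p)"
    using le[of "Suc _"] by (intro bounded_imp_summable[of _ M]) (auto simp: w_nonneg lessThan_Suc_atMost)
  with lim show "x \<in> lorentz_space w p" by (simp add: lorentz_space_def)
  show "lorentz_norm w p x powr p \<le> M"
    unfolding lorentz_norm_powr[OF lim sum] using sum le by (rule suminf_le_const)
qed

lemma lorentz_space_iff: "x \<in> lorentz_space w p \<longleftrightarrow> (\<exists>M. mod_le w p x M)"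
  using mod_le_lorentz_norm mod_le_in_lorentz_space by blast

end

lemma lp_norm_powr:
  assumes "1 \<le> p" "x \<in> lp_space p"
  shows "lp_norm p x powr p = (\<Sum>n. \<bar>x n\<bar> powr p)"
proof -
  have "0 \<le> (\<Sum>n. \<bar>x n\<bar> powr p)"
    using assms by (intro suminf_nonneg) (auto simp: lp_space_def)
  thus ?thesis using assms(1) by (simp add: lp_norm_def powr_powr)
qed

lemma mod_le_lp_norm:
  assumes "1 \<le> p" "x \<in> lp_space p"
  shows "mod_le (\<lambda>_. 1) p x (lp_norm p x powr p)"
  unfolding lp_norm_powr[OF assms]
  using assms by (intro mod_leI) (auto intro!: sum_le_suminf simp: lp_space_def)

lemma
  assumes "1 \<le> p" and x: "mod_le (\<lambda>_. 1) p x M"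
  shows mod_le_in_lp_space: "x \<in> lp_space p"
    and lp_norm_powr_le: "lp_norm p x powr p \<le> M"
proof -
  have le: "(\<Sum>n<K. \<bar>x n\<bar> powr p) \<le> M" for K
    using mod_leD[OF x, of "{..<K}" id] by simp
  have sum: "summable (\<lambda>n. \<bar>x n\<bar> powr p)"
    using le[of "Suc _"] by (intro bounded_imp_summable[of _ M]) (auto simp: lessThan_Suc_atMost)
  thus mem: "x \<in> lp_space p" by (simp add: lp_space_def)
  show "lp_norm p x powr p \<le> M"
    unfolding lp_norm_powr[OF assms(1) mem] using sum le by (rule suminf_le_const)
qed

section \<open>Operators and almost disjoint sequences\<close>

definition mod_space :: "(nat \<Rightarrow> real) \<Rightarrow> real \<Rightarrow> (nat \<Rightarrow> real) set" where
  "mod_space w p = {x. \<exists>M. mod_le w p x M}"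

text \<open>The constant bounds p-th powers, so it is the p-th power of an operator bound. A weight
  on each side makes operators on the Lorentz space, into l_p and out of l_p instances of one
  notion.\<close>

definition mod_op ::
  "(nat \<Rightarrow> real) \<Rightarrow> (nat \<Rightarrow> real) \<Rightarrow> real \<Rightarrow> ((nat \<Rightarrow> real) \<Rightarrow> nat \<Rightarrow> real) \<Rightarrow> bool" where
  "mod_op w v p T \<longleftrightarrow>
     (\<forall>x\<in>mod_space w p. \<forall>y\<in>mod_space w p. T (\<lambda>n. x n + y n) = (\<lambda>n. T x n + T y n)) \<and>
     (\<forall>x\<in>mod_space w p. \<forall>c. T (\<lambda>n. c * x n) = (\<lambda>n. c * T x n)) \<and>
     (\<exists>C\<ge>0. \<forall>x M. mod_le w p x M \<longrightarrow> mod_le v p (T x) (C * M))"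

lemma mod_spaceI: "mod_le w p x M \<Longrightarrow> x \<in> mod_space w p"
  by (auto simp: mod_space_def)

lemma mod_opI:
  assumes "\<And>x y. x \<in> mod_space w p \<Longrightarrow> y \<in> mod_space w p \<Longrightarrow> T (\<lambda>n. x n + y n) = (\<lambda>n. T x n + T y n)"
    and "\<And>x c. x \<in> mod_space w p \<Longrightarrow> T (\<lambda>n. c * x n) = (\<lambda>n. c * T x n)"
    and "0 \<le> C" "\<And>x M. mod_le w p x M \<Longrightarrow> mod_le v p (T x) (C * M)"
  shows "mod_op w v p T"
  using assms unfolding mod_op_def by blast

lemma mod_op_add:
  "mod_op w v p T \<Longrightarrow> x \<in> mod_space w p \<Longrightarrow> y \<in> mod_space w p \<Longrightarrow>
    T (\<lambda>n. x n + y n) = (\<lambda>n. T x n + T y n)"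
  unfolding mod_op_def by blast

lemma mod_op_scale:
  "mod_op w v p T \<Longrightarrow> x \<in> mod_space w p \<Longrightarrow> T (\<lambda>n. c * x n) = (\<lambda>n. c * T x n)"
  unfolding mod_op_def by blast

lemma mod_op_bounded:
  assumes "mod_op w v p T"
  obtains C where "0 \<le> C" "\<And>x M. mod_le w p x M \<Longrightarrow> mod_le v p (T x) (C * M)"
  using assms unfolding mod_op_def by blast

lemma mod_op_mem:
  assumes "mod_op w v p T" "x \<in> mod_space w p"
  shows "T x \<in> mod_space v p"
  using assms unfolding mod_op_def mod_space_def by blast

lemma mod_op_comp:
  assumes S: "mod_op u v p S" and T: "mod_op v w p T"
  shows "mod_op u w p (\<lambda>x. T (S x))"
proof -
  obtain C where C: "0 \<le> C" "\<And>x M. mod_le u p x M \<Longrightarrow> mod_le v p (S x) (C * M)"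
    using mod_op_bounded[OF S] by blast
  obtain D where D: "0 \<le> D" "\<And>x M. mod_le v p x M \<Longrightarrow> mod_le w p (T x) (D * M)"
    using mod_op_bounded[OF T] by blast
  show ?thesis
  proof (rule mod_opI[where C = "D * C"])
    fix x M assume "mod_le u p x M"
    from D(2)[OF C(2)[OF this]] show "mod_le w p (T (S x)) (D * C * M)" by (simp add: mult.assoc)
  qed (use C D in \<open>auto simp: mod_op_add[OF S] mod_op_scale[OF S] mod_op_add[OF T]
         mod_op_scale[OF T] mod_op_mem[OF S]\<close>)
qed

text \<open>Both hypothesis blocks say that the p-th power of the norm is the least modulus bound;
  they are kept abstract so that one proof covers Lorentz and l_p targets.\<close>

lemma bounded_op_iff_mod_op:
  assumes "0 < p"
    and X: "\<And>x. x \<in> X \<Longrightarrow> mod_le w p x (nX x powr p)"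
      "\<And>x M. mod_le w p x M \<Longrightarrow> x \<in> X" "\<And>x M. mod_le w p x M \<Longrightarrow> nX x powr p \<le> M"
    and Y: "\<And>x. x \<in> Y \<Longrightarrow> mod_le v p x (nY x powr p)"
      "\<And>x M. mod_le v p x M \<Longrightarrow> x \<in> Y" "\<And>x M. mod_le v p x M \<Longrightarrow> nY x powr p \<le> M"
    and nonneg: "\<And>x. 0 \<le> nX x" "\<And>x. 0 \<le> nY x"
  shows "bounded_op X nX Y nY T \<longleftrightarrow> mod_op w v p T"
proof
  have sp: "X = mod_space w p" using X unfolding mod_space_def by blast
  {
    assume T: "bounded_op X nX Y nY T"
    then obtain C where C: "\<And>x. x \<in> X \<Longrightarrow> nY (T x) \<le> C * nX x" and TY: "\<And>x. x \<in> X \<Longrightarrow> T x \<in> Y"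
      unfolding bounded_op_def by blast
    show "mod_op w v p T"
    \<comment> \<open>\<open>bounded_op\<close> permits a negative constant, hence the absolute
      value.\<close>
    proof (rule mod_opI[where C = "\<bar>C\<bar> powr p"])
      fix x M assume xM: "mod_le w p x M"
      have x: "x \<in> X" using X(2)[OF xM] .
      have "C * nX x \<le> \<bar>C\<bar> * nX x" using nonneg by (intro mult_right_mono) auto
      with C[OF x] have "nY (T x) powr p \<le> (\<bar>C\<bar> * nX x) powr p"
        using assms(1) nonneg by (intro powr_mono2) auto
      also have "\<dots> = \<bar>C\<bar> powr p * nX x powr p" using nonneg by (simp add: powr_mult)
      also have "\<dots> \<le> \<bar>C\<bar> powr p * M" using X(3)[OF xM] by (intro mult_left_mono) auto
      finally show "mod_le v p (T x) (\<bar>C\<bar> powr p * M)"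
        using Y(1)[OF TY[OF x]] mod_le_weaken by blast
    qed (use T in \<open>auto simp: bounded_op_def sp\<close>)
  next
    assume T: "mod_op w v p T"
    obtain C where C: "0 \<le> C" "\<And>x M. mod_le w p x M \<Longrightarrow> mod_le v p (T x) (C * M)"
      using mod_op_bounded[OF T] by blast
    have "nY (T x) \<le> C powr (1/p) * nX x" if x: "x \<in> X" for x
    proof -
      have "nY (T x) powr p \<le> C * nX x powr p" using Y(3)[OF C(2)[OF X(1)[OF x]]] .
      hence "(nY (T x) powr p) powr (1/p) \<le> (C * nX x powr p) powr (1/p)"
        using assms(1) by (intro powr_mono2) auto
      thus ?thesis using assms(1) nonneg C(1) by (simp add: powr_powr powr_mult)
    qed
    moreover have "T x \<in> Y" if "x \<in> X" for x
      using Y(2)[OF C(2)[OF X(1)[OF that]]] .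
    ultimately show "bounded_op X nX Y nY T"
      unfolding bounded_op_def using mod_op_add[OF T] mod_op_scale[OF T] unfolding sp by blast
  }
qed

section \<open>Almost disjoint sequences and their errors\<close>

definition block_err :: "(nat \<Rightarrow> nat) \<Rightarrow> (nat \<Rightarrow> nat \<Rightarrow> real) \<Rightarrow> nat \<Rightarrow> nat \<Rightarrow> real" where
  "block_err a y k = restr (- {a k..<a (Suc k)}) (y k)"

text \<open>The factors \<open>2 powr p\<close> absorb the constant of the quasi-triangle inequality, so that
  the errors of all \<open>y k\<close> together still have modulus at most \<open>c\<close>.\<close>
definition near_blocks ::
  "(nat \<Rightarrow> real) \<Rightarrow> real \<Rightarrow> (nat \<Rightarrow> nat) \<Rightarrow> (nat \<Rightarrow> nat \<Rightarrow> real) \<Rightarrow> real \<Rightarrow> bool" where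
  "near_blocks w p a y c \<longleftrightarrow>
     (\<forall>k. mod_le w p (block_err a y k) (c * (1/2) ^ Suc k / (2 powr p) ^ Suc k))"

text \<open>The bound of \<open>near_blocks\<close> divided by 2 * 2^p: an error consists of a head
  and a tail, and adding two parts of this size costs exactly that factor.\<close>

definition block_tol :: "real \<Rightarrow> real \<Rightarrow> nat \<Rightarrow> real" where
  "block_tol p c k = c * (1/2) ^ Suc k / (2 powr p) ^ Suc k / (2 * 2 powr p)"

lemma block_tol_pos: "0 < c \<Longrightarrow> 0 < block_tol p c k"
  by (simp add: block_tol_def)

lemma disjoint_supports_blocks:
  assumes "strict_mono a"
  shows "disjoint_supports (\<lambda>k. restr {a k..<a (Suc k)} (y k))"
  unfolding disjoint_supports_def
proof (intro allI impI)
  fix i k l assume "restr {a k..<a (Suc k)} (y k) i \<noteq> 0" "restr {a l..<a (Suc l)} (y l) i \<noteq> 0"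
  hence i: "a k \<le> i" "i < a (Suc k)" "a l \<le> i" "i < a (Suc l)"
    by (auto simp: restr_def split: if_splits)
  have "a k < a (Suc l)" "a l < a (Suc k)" using i by linarith+
  hence "k < Suc l" "l < Suc k" using assms by (simp_all add: strict_mono_less)
  thus "k = l" by simp
qed

lemma sum_blocks_plus_err:
  fixes y :: "nat \<Rightarrow> nat \<Rightarrow> real"
  shows "(\<Sum>k<n. \<alpha> k * y k i)
    = (\<Sum>k<n. \<alpha> k * restr {a k..<a (Suc k)} (y k) i) + (\<Sum>k<n. \<alpha> k * block_err a y k i)"
  unfolding sum.distrib[symmetric] by (intro sum.cong) (auto simp: block_err_def restr_def)

lemma sum_half_powers_le: "(\<Sum>k<n. (1/2::real) ^ Suc k) \<le> 1"
proof -
  have "(\<Sum>k<n. (1/2::real) ^ Suc k) = 1 - (1/2) ^ n" by (induction n) auto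
  thus ?thesis by simp
qed

context lorentz_weight
begin

lemma near_blocksI:
  assumes "\<And>k. mod_le w p (restr {..<a k} (y k)) (block_tol p c k)"
    and "\<And>k. mod_le w p (restr {a (Suc k)..} (y k)) (block_tol p c k)"
  shows "near_blocks w p a y c"
  unfolding near_blocks_def
proof
  fix k
  show "mod_le w p (block_err a y k) (c * (1/2) ^ Suc k / (2 powr p) ^ Suc k)"
  proof (rule mod_le_mono)
    show "mod_le w p (\<lambda>i. \<bar>restr {..<a k} (y k) i\<bar> + \<bar>restr {a (Suc k)..} (y k) i\<bar>)
        (2 powr p * (block_tol p c k + block_tol p c k))"
      by (intro mod_le_add) (auto intro: mod_le_mono[OF assms(1)] mod_le_mono[OF assms(2)])
  qed (auto simp: block_err_def restr_def block_tol_def)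
qed

lemma near_blocks_nonneg:
  assumes "near_blocks w p a y c"
  shows "0 \<le> c"
proof -
  have "0 \<le> c * (1/2) ^ Suc 0 / (2 powr p) ^ Suc 0"
    using assms unfolding near_blocks_def by (blast dest: mod_le_nonneg)
  thus ?thesis by (simp add: zero_le_divide_iff)
qed

text \<open>The constants of \<open>mod_le_sum_quasi\<close> cancel the denominators in
  \<open>near_blocks\<close> and leave a geometric series. Only a uniform bound on the coefficients
  is used, which is what later brings solutions among bounded sequences back to the Lorentz
  space.\<close>

lemma near_blocks_err_sum:
  assumes nb: "near_blocks w p a y c" and \<alpha>: "\<And>k. k < n \<Longrightarrow> \<bar>\<alpha> k\<bar> powr p \<le> S" and "0 \<le> S"
  shows "mod_le w p (\<lambda>i. \<Sum>k<n. \<alpha> k * block_err a y k i) (c * S)"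
proof (rule mod_le_weaken)
  let ?D = "2 powr p"
  show "mod_le w p (\<lambda>i. \<Sum>k<n. \<alpha> k * block_err a y k i)
      (\<Sum>k<n. ?D ^ Suc k * (S * (c * (1/2) ^ Suc k / ?D ^ Suc k)))"
  proof (rule mod_le_sum_quasi)
    fix k assume "k < n"
    have b: "mod_le w p (block_err a y k) (c * (1/2) ^ Suc k / ?D ^ Suc k)"
      using nb by (simp add: near_blocks_def)
    show "mod_le w p (\<lambda>i. \<alpha> k * block_err a y k i) (S * (c * (1/2) ^ Suc k / ?D ^ Suc k))"
      using \<alpha>[OF \<open>k < n\<close>] mod_le_nonneg[OF b]
      by (intro mod_le_weaken[OF mod_le_scale[OF b]] mult_right_mono)
  qed
  have "(\<Sum>k<n. ?D ^ Suc k * (S * (c * (1/2) ^ Suc k / ?D ^ Suc k))) = c * S * (\<Sum>k<n. (1/2) ^ Suc k)"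
    unfolding sum_distrib_left by (intro sum.cong) (auto simp: field_simps)
  also have "\<dots> \<le> c * S * 1"
    using near_blocks_nonneg[OF nb] \<open>0 \<le> S\<close> by (intro mult_left_mono sum_half_powers_le) auto
  finally show "(\<Sum>k<n. ?D ^ Suc k * (S * (c * (1/2) ^ Suc k / ?D ^ Suc k))) \<le> c * S" by simp
qed

text \<open>Taking as coefficients the signs of the errors at coordinate \<open>i\<close> turns the
  modulus bound for signed sums into an absolute one.\<close>

lemma near_blocks_abs_err:
  assumes "near_blocks w p a y c"
  shows "(\<Sum>k<n. \<bar>block_err a y k i\<bar>) \<le> c powr (1/p)"
proof -
  have "mod_le w p (\<lambda>j. \<Sum>k<n. sgn (block_err a y k i) * block_err a y k j) (c * 1)"
    using p_pos by (intro near_blocks_err_sum assms) (auto simp: sgn_if)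
  from mod_le_point[OF this, of i]
  have "\<bar>\<Sum>k<n. sgn (block_err a y k i) * block_err a y k i\<bar> \<le> c powr (1/p)" by simp
  also have "(\<Sum>k<n. sgn (block_err a y k i) * block_err a y k i) = (\<Sum>k<n. \<bar>block_err a y k i\<bar>)"
    by (intro sum.cong) (auto simp: abs_sgn mult.commute)
  finally show ?thesis by linarith
qed

text \<open>The parts inside the blocks are disjoint and obey the upper p-estimate; for the errors,
  each \<bar>\<alpha> k\<bar>^p is at most the whole sum. This makes synthesis bounded from
  l_p.\<close>

lemma near_blocks_sum:
  assumes "strict_mono a" and nb: "near_blocks w p a y c" and y: "\<And>k. mod_le w p (y k) M"
  shows "mod_le w p (\<lambda>i. \<Sum>k<n. \<alpha> k * y k i) (2 powr p * (M + c) * (\<Sum>k<n. \<bar>\<alpha> k\<bar> powr p))"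
proof -
  let ?S = "\<Sum>k<n. \<bar>\<alpha> k\<bar> powr p"
  have ds: "disjoint_supports (\<lambda>k i. \<alpha> k * restr {a k..<a (Suc k)} (y k) i)"
    using disjoint_supports_blocks[OF assms(1), of y]
    unfolding disjoint_supports_def by (metis mult_zero_right)
  have 1: "mod_le w p (\<lambda>i. \<Sum>k<n. \<alpha> k * restr {a k..<a (Suc k)} (y k) i) (\<Sum>k<n. \<bar>\<alpha> k\<bar> powr p * M)"
    by (intro mod_le_sum_disjoint ds mod_le_scale mod_le_restr y)
  have 2: "mod_le w p (\<lambda>i. \<Sum>k<n. \<alpha> k * block_err a y k i) (c * ?S)"
    by (rule near_blocks_err_sum[OF nb]) (auto intro!: member_le_sum sum_nonneg)
  have "2 powr p * ((\<Sum>k<n. \<bar>\<alpha> k\<bar> powr p * M) + c * ?S) = 2 powr p * (M + c) * ?S"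
    unfolding sum_distrib_right[symmetric] by (simp add: algebra_simps)
  with mod_le_add[OF 1 2] show ?thesis
    unfolding sum_blocks_plus_err[of \<alpha> y _ n a] by simp
qed

lemma mod_space_add:
  assumes "x \<in> mod_space w p" "y \<in> mod_space w p"
  shows "(\<lambda>i. x i + y i) \<in> mod_space w p"
  using assms unfolding mod_space_def by (auto dest: mod_le_add)

lemma mod_space_scale:
  assumes "x \<in> mod_space w p"
  shows "(\<lambda>i. c * x i) \<in> mod_space w p"
  using assms unfolding mod_space_def by (auto dest: mod_le_scale)

lemma mod_space_sum:
  assumes "\<And>k. k < (n::nat) \<Longrightarrow> x k \<in> mod_space w p"
  shows "(\<lambda>i. \<Sum>k<n. \<alpha> k * x k i) \<in> mod_space w p"
  using assms
proof (induction n)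
  case 0
  show ?case using mod_spaceI[OF mod_le_zero] by simp
next
  case (Suc n)
  thus ?case using mod_space_add[OF Suc.IH mod_space_scale[of "x n" "\<alpha> n"]] by simp
qed

lemma mod_op_sum:
  assumes T: "mod_op w v p T" and "\<And>k. k < (n::nat) \<Longrightarrow> x k \<in> mod_space w p"
  shows "T (\<lambda>i. \<Sum>k<n. \<alpha> k * x k i) = (\<lambda>i. \<Sum>k<n. \<alpha> k * T (x k) i)"
  using assms(2)
proof (induction n)
  case 0
  show ?case using mod_op_scale[OF T mod_spaceI[OF mod_le_zero], of 0] by simp
next
  case (Suc n)
  have "T (\<lambda>i. (\<Sum>k<n. \<alpha> k * x k i) + \<alpha> n * x n i)
      = (\<lambda>i. T (\<lambda>i. \<Sum>k<n. \<alpha> k * x k i) i + T (\<lambda>i. \<alpha> n * x n i) i)"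
    using Suc.prems by (intro mod_op_add[OF T] mod_space_sum mod_space_scale) auto
  thus ?case using Suc by (simp add: mod_op_scale[OF T])
qed

lemma mod_op_diff:
  assumes T: "mod_op w v p T" and "x \<in> mod_space w p" "y \<in> mod_space w p"
  shows "T (\<lambda>n. x n - y n) = (\<lambda>n. T x n - T y n)"
  using mod_op_add[OF T assms(2) mod_space_scale[OF assms(3), of "-1"]]
    mod_op_scale[OF T assms(3), of "-1"] by simp

end

text \<open>The selection scheme of a gliding hump: \<open>r k\<close> picks vectors and
  \<open>a k\<close> cut points. The cut \<open>a (Suc k)\<close> is chosen after \<open>r k\<close>
  so that \<open>P\<close> holds (small tails), the vector \<open>r (Suc k)\<close> after that cut
  so that \<open>Q\<close> holds (small heads).\<close>

lemma alternating_choice: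
  fixes P Q :: "nat \<Rightarrow> nat \<Rightarrow> nat \<Rightarrow> bool"
  assumes P: "\<And>k r. \<forall>\<^sub>F a in sequentially. P k r a" and Q: "\<And>k a. \<forall>\<^sub>F r in sequentially. Q k a r"
  obtains r a :: "nat \<Rightarrow> nat"
  where "strict_mono r" "strict_mono a" "\<And>k. Q k (a k) (r k)" "\<And>k. P k (r k) (a (Suc k))"
proof -
  have ex: "\<exists>a' r'. a < a' \<and> r < r' \<and> P k r a' \<and> Q (Suc k) a' r'" for a r k
  proof -
    obtain a' where a': "a < a'" "P k r a'"
      using eventually_happens'[OF _ eventually_conj[OF eventually_gt_at_top P]] by force
    obtain r' where "r < r'" "Q (Suc k) a' r'"
      using eventually_happens'[OF _ eventually_conj[OF eventually_gt_at_top Q]] by force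
    with a' show ?thesis by blast
  qed
  obtain r0 where r0: "Q 0 0 r0"
    using eventually_happens'[OF _ Q[of 0 0]] by auto
  have "\<exists>f. \<forall>n. (case f n of (a, r) \<Rightarrow> Q n a r) \<and>
      (case f n of (a, r) \<Rightarrow> case f (Suc n) of (a', r') \<Rightarrow> a < a' \<and> r < r' \<and> P n r a')"
  proof (rule dependent_nat_choice)
    show "\<exists>x. case x of (a, r) \<Rightarrow> Q 0 a r" using r0 by auto
    show "\<exists>y. (case y of (a, r) \<Rightarrow> Q (Suc n) a r) \<and>
        (case x of (a, r) \<Rightarrow> case y of (a', r') \<Rightarrow> a < a' \<and> r < r' \<and> P n r a')" for x n
      using ex[of "fst x" "snd x" n] by (auto simp: case_prod_beta)
  qed
  then obtain f where f: "\<And>n. Q n (fst (f n)) (snd (f n))"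
    "\<And>n. fst (f n) < fst (f (Suc n))" "\<And>n. snd (f n) < snd (f (Suc n))"
    "\<And>n. P n (snd (f n)) (fst (f (Suc n)))"
    by (auto simp: case_prod_beta)
  show ?thesis
    by (rule that[of "\<lambda>n. snd (f n)" "\<lambda>n. fst (f n)"]) (auto simp: strict_mono_Suc_iff f)
qed

section \<open>Synthesis operators and perturbations of the identity\<close>

definition synth :: "(nat \<Rightarrow> nat \<Rightarrow> real) \<Rightarrow> (nat \<Rightarrow> real) \<Rightarrow> nat \<Rightarrow> real" where
  "synth y \<alpha> i = (\<Sum>k. \<alpha> k * y k i)"

context lorentz_weight
begin

lemma near_blocks_err_summable:
  assumes "near_blocks w p a y c"
  shows "summable (\<lambda>k. \<bar>block_err a y k i\<bar>)"
proof (rule bounded_imp_summable)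
  show "(\<Sum>k\<le>n. \<bar>block_err a y k i\<bar>) \<le> c powr (1/p)" for n
    using near_blocks_abs_err[OF assms] unfolding lessThan_Suc_atMost[symmetric] .
qed auto

lemma near_blocks_summable:
  assumes a: "strict_mono a" and nb: "near_blocks w p a y c" and \<alpha>: "\<And>k. \<bar>\<alpha> k\<bar> \<le> S"
  shows "summable (\<lambda>k. \<alpha> k * y k i)"
proof (rule summable_comparison_test_ev)
  show "summable (\<lambda>k. S * \<bar>block_err a y k i\<bar>)"
    by (intro summable_mult near_blocks_err_summable[OF nb])
  show "\<forall>\<^sub>F k in sequentially. norm (\<alpha> k * y k i) \<le> S * \<bar>block_err a y k i\<bar>"
    using eventually_gt_at_top[of i]
  proof eventually_elim
    case (elim k)
    \<comment> \<open>Since k \<le> \<open>a k\<close>, coordinate \<open>i\<close> lies before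
      block \<open>k\<close> as soon as k > i, so \<open>y k i\<close> is then purely an
      error.\<close>
    have "i < a k" using strict_mono_imp_increasing[OF a, of k] elim by simp
    thus ?case using \<alpha>[of k] by (auto simp: block_err_def restr_def abs_mult intro!: mult_right_mono)
  qed
qed

lemma synth_mod_le:
  assumes "strict_mono a" "near_blocks w p a y c" "\<And>k. mod_le w p (y k) M"
    and \<alpha>: "mod_le (\<lambda>_. 1) p \<alpha> Q"
  shows "mod_le w p (synth y \<alpha>) (2 powr p * (M + c) * Q)"
proof -
  interpret one: lorentz_weight "\<lambda>_. 1" p by (rule lorentz_weight_one[OF p_ge_1])
  have "0 \<le> M" "0 \<le> c" using mod_le_nonneg[OF assms(3)] near_blocks_nonneg[OF assms(2)] by auto
  hence b: "mod_le w p (\<lambda>i. \<Sum>k<n. \<alpha> k * y k i) (2 powr p * (M + c) * Q)" for n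
    using mod_leD[OF \<alpha>, of "{..<n}" id]
    by (intro mod_le_weaken[OF near_blocks_sum[OF assms(1-3)]] mult_left_mono) auto
  show ?thesis
  proof (rule mod_le_limit[OF b])
    show "(\<lambda>n. \<Sum>k<n. \<alpha> k * y k i) \<longlonglongrightarrow> synth y \<alpha> i" for i
      unfolding synth_def
      by (intro summable_LIMSEQ near_blocks_summable[OF assms(1,2), where S = "Q powr (1/p)"]
            one.mod_le_point[OF \<alpha>])
  qed
qed

lemma synth_mod_op:
  assumes "strict_mono a" "near_blocks w p a y c" "\<And>k. mod_le w p (y k) M"
  shows "mod_op (\<lambda>_. 1) w p (synth y)"
proof -
  interpret one: lorentz_weight "\<lambda>_. 1" p by (rule lorentz_weight_one[OF p_ge_1])
  have sum: "summable (\<lambda>k. \<alpha> k * y k i)" if \<alpha>: "\<alpha> \<in> mod_space (\<lambda>_. 1) p" for \<alpha> i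
  proof -
    obtain Q where "mod_le (\<lambda>_. 1) p \<alpha> Q" using \<alpha> by (auto simp: mod_space_def)
    hence "\<bar>\<alpha> k\<bar> \<le> Q powr (1/p)" for k by (rule one.mod_le_point)
    thus ?thesis by (rule near_blocks_summable[OF assms(1,2)])
  qed
  show ?thesis
  proof (rule mod_opI[where C = "2 powr p * (M + c)"])
    fix \<alpha> \<beta> assume "\<alpha> \<in> mod_space (\<lambda>_. 1) p" "\<beta> \<in> mod_space (\<lambda>_. 1) p"
    thus "synth y (\<lambda>n. \<alpha> n + \<beta> n) = (\<lambda>n. synth y \<alpha> n + synth y \<beta> n)"
      by (simp add: fun_eq_iff synth_def distrib_right suminf_add[symmetric] sum)
  next
    fix \<alpha> r assume "\<alpha> \<in> mod_space (\<lambda>_. 1) p"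
    thus "synth y (\<lambda>n. r * \<alpha> n) = (\<lambda>n. r * synth y \<alpha> n)"
      by (simp add: fun_eq_iff synth_def mult.assoc suminf_mult sum)
  next
    show "0 \<le> 2 powr p * (M + c)"
      using mod_le_nonneg[OF assms(3)] near_blocks_nonneg[OF assms(2)] by simp
  qed (rule synth_mod_le[OF assms])
qed

text \<open>A bounded operator passes through the infinite sum at each coordinate: what remains is
  the image of the synthesis of a tail of \<open>\<alpha>\<close>, and tails in l_p have small
  modulus.\<close>

lemma mod_op_synth_sums:
  assumes nb: "strict_mono a" "near_blocks w p a y c" and y: "\<And>k. mod_le w p (y k) M"
    and v: "lorentz_weight v p" and T: "mod_op w v p T" and \<alpha>: "mod_le (\<lambda>_. 1) p \<alpha> Q"
  shows "(\<lambda>k. \<alpha> k * T (y k) i) sums T (synth y \<alpha>) i"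
proof -
  interpret one: lorentz_weight "\<lambda>_. 1" p by (rule lorentz_weight_one[OF p_ge_1])
  interpret v: lorentz_weight v p by (rule v)
  obtain C where C: "0 \<le> C" "\<And>x M. mod_le w p x M \<Longrightarrow> mod_le v p (T x) (C * M)"
    using mod_op_bounded[OF T] by blast
  define K where "K = C * (2 powr p * (M + c))"
  have K: "0 \<le> K"
    using C mod_le_nonneg[OF y] near_blocks_nonneg[OF nb(2)] by (simp add: K_def)
  have synth_mem: "synth y \<beta> \<in> mod_space w p" if "mod_le (\<lambda>_. 1) p \<beta> Q" for \<beta> Q
    using synth_mod_le[OF nb y that] by (rule mod_spaceI)
  have rest: "T (synth y \<alpha>) i - (\<Sum>k<n. \<alpha> k * T (y k) i) = T (synth y (restr {n..} \<alpha>)) i" for n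
  proof -
    have split: "synth y \<alpha> = (\<lambda>i. (\<Sum>k<n. \<alpha> k * y k i) + synth y (restr {n..} \<alpha>) i)"
    proof
      fix i
      have eq: "(\<lambda>k. \<alpha> k * y k i)
          = (\<lambda>k. (if k \<in> {..<n} then \<alpha> k * y k i else 0) + restr {n..} \<alpha> k * y k i)"
        by (auto simp: restr_def)
      have "summable (\<lambda>k. restr {n..} \<alpha> k * y k i)"
        by (intro near_blocks_summable[OF nb, where S = "Q powr (1/p)"] one.mod_le_point
              one.mod_le_restr \<alpha>)
      hence "(\<lambda>k. restr {n..} \<alpha> k * y k i) sums synth y (restr {n..} \<alpha>) i"
        unfolding synth_def by (rule summable_sums)
      from sums_add[OF sums_If_finite_set[of "{..<n}" "\<lambda>k. \<alpha> k * y k i"] this]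
      show "synth y \<alpha> i = (\<Sum>k<n. \<alpha> k * y k i) + synth y (restr {n..} \<alpha>) i"
        unfolding synth_def[of y \<alpha>] eq[symmetric] by (simp add: sums_iff)
    qed
    have "T (synth y \<alpha>) = (\<lambda>i. T (\<lambda>i. \<Sum>k<n. \<alpha> k * y k i) i + T (synth y (restr {n..} \<alpha>)) i)"
      by (subst split, intro mod_op_add[OF T] mod_space_sum mod_spaceI[OF y] synth_mem[OF one.mod_le_restr[OF \<alpha>]])
    also have "T (\<lambda>i. \<Sum>k<n. \<alpha> k * y k i) = (\<lambda>i. \<Sum>k<n. \<alpha> k * T (y k) i)"
      by (intro mod_op_sum[OF T] mod_spaceI[OF y])
    finally show ?thesis by (metis add_diff_cancel_left')
  qed
  have "(\<lambda>n. T (synth y (restr {n..} \<alpha>)) i) \<longlonglongrightarrow> 0"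
  proof (rule tendstoI)
    fix e :: real assume e: "0 < e"
    \<comment> \<open>\<open>K + 1\<close> instead of \<open>K\<close>, which may be 0; e/2 makes
      the final inequality strict.\<close>
    define \<epsilon> where "\<epsilon> = (e/2) powr p / (K + 1)"
    have \<epsilon>: "0 < \<epsilon>" using e K by (simp add: \<epsilon>_def)
    show "\<forall>\<^sub>F n in sequentially. dist (T (synth y (restr {n..} \<alpha>)) i) 0 < e"
      using one.eventually_mod_le_tail[OF \<alpha> \<epsilon>]
    proof eventually_elim
      case (elim n)
      have "K * \<epsilon> \<le> (K + 1) * \<epsilon>" using \<epsilon> by (intro mult_right_mono) auto
      also have "\<dots> = (e/2) powr p" using K by (simp add: \<epsilon>_def)
      finally have "mod_le v p (T (synth y (restr {n..} \<alpha>))) ((e/2) powr p)"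
        using C(2)[OF synth_mod_le[OF nb y elim]] mod_le_weaken by (simp add: K_def mult.assoc)
      from v.mod_le_point[OF this, of i] have "\<bar>T (synth y (restr {n..} \<alpha>)) i\<bar> \<le> e/2"
        using e p_pos by (simp add: powr_powr)
      thus ?case using e by simp
    qed
  qed
  hence "(\<lambda>n. T (synth y \<alpha>) i - T (synth y (restr {n..} \<alpha>)) i) \<longlonglongrightarrow> T (synth y \<alpha>) i - 0"
    by (intro tendsto_diff tendsto_const)
  thus ?thesis unfolding sums_def rest[symmetric] by simp
qed

end

section \<open>Inverting the identity plus a small kernel on bounded sequences\<close>

lemma summable_kernel_row:
  fixes e :: "nat \<Rightarrow> nat \<Rightarrow> real"
  assumes e: "\<And>n. (\<Sum>i<n. \<bar>e k i\<bar>) \<le> q" and x: "\<And>i. \<bar>x i\<bar> \<le> B"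
  shows "summable (\<lambda>i. x i * e k i)" and "\<bar>\<Sum>i. x i * e k i\<bar> \<le> q * B"
proof -
  have s: "summable (\<lambda>i. \<bar>e k i\<bar>)"
    using e[of "Suc _"] by (intro bounded_imp_summable[of _ q]) (auto simp: lessThan_Suc_atMost)
  have B: "0 \<le> B" using x[of 0] by simp
  have le: "norm (x i * e k i) \<le> B * \<bar>e k i\<bar>" for i
    using x[of i] by (simp add: abs_mult mult_right_mono)
  show sum: "summable (\<lambda>i. x i * e k i)"
    by (rule summable_comparison_test'[OF summable_mult[OF s, of B]]) (rule le)
  have "norm (\<Sum>i. x i * e k i) \<le> (\<Sum>i. B * \<bar>e k i\<bar>)"
    by (rule norm_suminf_le[OF le summable_mult[OF s]])
  also have "\<dots> = B * (\<Sum>i. \<bar>e k i\<bar>)" using s by (rule suminf_mult)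
  also have "\<dots> \<le> B * q" using B s e by (intro mult_left_mono suminf_le_const) auto
  finally show "\<bar>\<Sum>i. x i * e k i\<bar> \<le> q * B" by (simp add: mult.commute)
qed

text \<open>This is (I + E) x = b for the kernel \<open>e\<close>. Boundedness is included because
  it makes the row series converge for absolutely summable rows and because uniqueness is meant
  among bounded sequences.\<close>

definition solves :: "(nat \<Rightarrow> nat \<Rightarrow> real) \<Rightarrow> (nat \<Rightarrow> real) \<Rightarrow> (nat \<Rightarrow> real) \<Rightarrow> bool" where
  "solves e b x \<longleftrightarrow> (\<exists>B. \<forall>i. \<bar>x i\<bar> \<le> B) \<and> (\<forall>k. x k + (\<Sum>i. x i * e k i) = b k)"

lemma kernel_row_diff:
  fixes e :: "nat \<Rightarrow> nat \<Rightarrow> real"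
  assumes e: "\<And>n. (\<Sum>i<n. \<bar>e k i\<bar>) \<le> q" and "\<And>i. \<bar>x i\<bar> \<le> B" "\<And>i. \<bar>x' i\<bar> \<le> B'"
    and d: "\<And>i. \<bar>x i - x' i\<bar> \<le> D"
  shows "\<bar>(\<Sum>i. x i * e k i) - (\<Sum>i. x' i * e k i)\<bar> \<le> q * D"
proof -
  have "(\<Sum>i. x i * e k i) - (\<Sum>i. x' i * e k i) = (\<Sum>i. x i * e k i - x' i * e k i)"
    by (intro suminf_diff summable_kernel_row(1)[of e k q x B, OF e]
          summable_kernel_row(1)[of e k q x' B', OF e] assms)
  also have "\<dots> = (\<Sum>i. (x i - x' i) * e k i)" by (simp add: left_diff_distrib)
  also have "\<bar>\<dots>\<bar> \<le> q * D" by (rule summable_kernel_row(2)[of e k q, OF e d])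
  finally show ?thesis .
qed

text \<open>The iteration x -> b - E x, started at 0, contracts the sup norm by 1/2; the bound 2 *
  \<beta> is \<beta> / (1 - 1/2). \<open>kernel_row_diff\<close> lets the limit pass through the row
  sums.\<close>

lemma solves_exists:
  assumes e: "\<And>n k. (\<Sum>i<n. \<bar>e k i\<bar>) \<le> 1/2" and b: "\<And>k. \<bar>b k\<bar> \<le> \<beta>"
  obtains x where "solves e b x" "\<And>k. \<bar>x k\<bar> \<le> 2 * \<beta>"
proof -
  define y where "y = rec_nat (\<lambda>_. 0) (\<lambda>_ x k. b k - (\<Sum>i. x i * e k i))"
  have y0: "y 0 k = 0" and ySuc: "y (Suc n) k = b k - (\<Sum>i. y n i * e k i)" for n k
    by (simp_all add: y_def)
  have y_le: "\<forall>k. \<bar>y n k\<bar> \<le> 2 * \<beta>" for n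
  proof (induction n)
    case 0
    show ?case using b[of 0] by (simp add: y0)
  next
    case (Suc n)
    hence E: "\<bar>\<Sum>i. y n i * e k i\<bar> \<le> 1/2 * (2 * \<beta>)" for k
      by (intro summable_kernel_row(2)[OF e]) auto
    have "\<bar>y (Suc n) k\<bar> \<le> 2 * \<beta>" for k using b[of k] E[of k] unfolding ySuc by linarith
    thus ?case by blast
  qed
  have dist_le: "\<forall>k. \<bar>y (m + n) k - y n k\<bar> \<le> 2 * \<beta> * (1/2) ^ n" for m n
  proof (induction n)
    case 0
    show ?case using y_le[of m] by (simp add: y0)
  next
    case (Suc n)
    have "\<bar>(\<Sum>i. y (m + n) i * e k i) - (\<Sum>i. y n i * e k i)\<bar> \<le> 1/2 * (2 * \<beta> * (1/2) ^ n)" for k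
      using Suc y_le by (intro kernel_row_diff[OF e]) auto
    thus ?case by (simp add: ySuc abs_minus_commute)
  qed
  have geo: "(\<lambda>n. 2 * \<beta> * (1/2) ^ n) \<longlonglongrightarrow> 0"
    by (intro tendsto_mult_right_zero LIMSEQ_realpow_zero) auto
  have "convergent (\<lambda>n. y n k)" for k
  proof (rule Cauchy_convergent, rule CauchyI')
    fix \<epsilon> :: real assume "0 < \<epsilon>"
    then obtain n0 where n0: "2 * \<beta> * (1/2) ^ n < \<epsilon>" if "n \<ge> n0" for n
      using order_tendstoD(2)[OF geo] by (auto simp: eventually_at_top_linorder)
    show "\<exists>M. \<forall>m\<ge>M. \<forall>n>m. dist (y m k) (y n k) < \<epsilon>"
    proof (intro exI[of _ n0] allI impI)
      fix m n assume "n0 \<le> m" "m < n"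
      hence "\<bar>y n k - y m k\<bar> \<le> 2 * \<beta> * (1/2) ^ m"
        using dist_le[of "n - m" m] by simp
      thus "dist (y m k) (y n k) < \<epsilon>"
        using n0[OF \<open>n0 \<le> m\<close>] by (simp add: dist_real_def abs_minus_commute)
    qed
  qed
  define x where "x k = lim (\<lambda>n. y n k)" for k
  have x: "(\<lambda>n. y n k) \<longlonglongrightarrow> x k" for k
    using \<open>\<And>k. convergent (\<lambda>n. y n k)\<close> by (simp add: x_def convergent_LIMSEQ_iff)
  have x_le: "\<bar>x k\<bar> \<le> 2 * \<beta>" for k
    by (rule LIMSEQ_le_const2[OF tendsto_rabs[OF x]]) (use y_le in auto)
  have xy: "\<bar>y n k - x k\<bar> \<le> 2 * \<beta> * (1/2) ^ n" for n k
  proof -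
    have "(\<lambda>m. \<bar>y (m + n) k - y n k\<bar>) \<longlonglongrightarrow> \<bar>x k - y n k\<bar>"
      by (intro tendsto_rabs tendsto_diff tendsto_const LIMSEQ_ignore_initial_segment x)
    from LIMSEQ_le_const2[OF this] show ?thesis using dist_le by (auto simp: abs_minus_commute)
  qed
  have "x k + (\<Sum>i. x i * e k i) = b k" for k
  proof -
    have "\<bar>(\<Sum>i. y n i * e k i) - (\<Sum>i. x i * e k i)\<bar> \<le> 1/2 * (2 * \<beta> * (1/2) ^ n)" for n
      using y_le x_le xy by (intro kernel_row_diff[OF e]) auto
    hence "(\<lambda>n. (\<Sum>i. y n i * e k i) - (\<Sum>i. x i * e k i)) \<longlonglongrightarrow> 0"
      by (intro Lim_null_comparison[OF _ tendsto_mult_right_zero[OF geo, of "1/2"]]) auto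
    from tendsto_diff[OF tendsto_const[of "b k"] this]
    have "(\<lambda>n. b k - ((\<Sum>i. y n i * e k i) - (\<Sum>i. x i * e k i))) \<longlonglongrightarrow> b k" by simp
    moreover have "(\<lambda>n. y (Suc n) k + (\<Sum>i. x i * e k i)) \<longlonglongrightarrow> x k + (\<Sum>i. x i * e k i)"
      by (intro tendsto_add tendsto_const LIMSEQ_Suc x)
    hence "(\<lambda>n. b k - ((\<Sum>i. y n i * e k i) - (\<Sum>i. x i * e k i))) \<longlonglongrightarrow> x k + (\<Sum>i. x i * e k i)"
      by (simp add: ySuc algebra_simps)
    ultimately show ?thesis using LIMSEQ_unique by blast
  qed
  thus ?thesis using x_le by (intro that[of x]) (auto simp: solves_def)
qed

lemma solves_add:
  assumes e: "\<And>n k. (\<Sum>i<n. \<bar>e k i\<bar>) \<le> q" and "solves e b x" "solves e b' x'"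
  shows "solves e (\<lambda>k. b k + b' k) (\<lambda>k. x k + x' k)"
proof -
  obtain B B' where B: "\<And>i. \<bar>x i\<bar> \<le> B" "\<And>i. \<bar>x' i\<bar> \<le> B'"
    using assms unfolding solves_def by blast
  have 1: "\<bar>x i + x' i\<bar> \<le> B + B'" for i using B[of i] by linarith
  have 2: "(\<Sum>i. (x i + x' i) * e k i) = (\<Sum>i. x i * e k i) + (\<Sum>i. x' i * e k i)" for k
    unfolding distrib_right
    by (intro suminf_add[symmetric] summable_kernel_row(1)[OF e B(1)] summable_kernel_row(1)[OF e B(2)])
  have 3: "x k + (\<Sum>i. x i * e k i) = b k" "x' k + (\<Sum>i. x' i * e k i) = b' k" for k
    using assms(2,3) unfolding solves_def by blast+
  have "x k + x' k + (\<Sum>i. (x i + x' i) * e k i) = b k + b' k" for k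
    unfolding 2 using 3[of k] by linarith
  with 1 show ?thesis unfolding solves_def by blast
qed

lemma solves_scale:
  assumes e: "\<And>n k. (\<Sum>i<n. \<bar>e k i\<bar>) \<le> q" and "solves e b x"
  shows "solves e (\<lambda>k. r * b k) (\<lambda>k. r * x k)"
proof -
  obtain B where B: "\<And>i. \<bar>x i\<bar> \<le> B"
    using assms unfolding solves_def by blast
  have "\<bar>r * x i\<bar> \<le> \<bar>r\<bar> * B" for i using B[of i] by (simp add: abs_mult mult_left_mono)
  moreover have "(\<Sum>i. r * x i * e k i) = r * (\<Sum>i. x i * e k i)" for k
    unfolding mult.assoc by (intro suminf_mult summable_kernel_row(1)[OF e B])
  moreover have "r * x k + r * (\<Sum>i. x i * e k i) = r * b k" for k
    using assms(2) unfolding solves_def by (metis distrib_left)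
  ultimately show ?thesis by (auto simp: solves_def)
qed

text \<open>The difference d of two solutions satisfies d = - E d, so any bound for it can be halved
  repeatedly. Uniqueness is what makes the solution operator linear.\<close>

lemma solves_unique:
  assumes e: "\<And>n k. (\<Sum>i<n. \<bar>e k i\<bar>) \<le> 1/2" and "solves e b x" "solves e b x'"
  shows "x = x'"
proof -
  define d where "d k = x k + - 1 * x' k" for k
  have d: "solves e (\<lambda>k. b k + - 1 * b k) d"
    unfolding d_def by (intro solves_add[OF e] solves_scale[OF e] assms)
  then obtain B where B: "\<And>i. \<bar>d i\<bar> \<le> B" by (auto simp: solves_def)
  have eq: "d k + (\<Sum>i. d i * e k i) = 0" for k using d by (simp add: solves_def)
  have pow: "\<forall>i. \<bar>d i\<bar> \<le> B * (1/2) ^ n" for n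
  proof (induction n)
    case 0
    show ?case using B by simp
  next
    case (Suc n)
    hence "\<bar>\<Sum>i. d i * e k i\<bar> \<le> 1/2 * (B * (1/2) ^ n)" for k
      by (intro summable_kernel_row(2)[OF e]) auto
    moreover have "\<bar>d k\<bar> = \<bar>\<Sum>i. d i * e k i\<bar>" for k using eq[of k] by linarith
    ultimately show ?case by simp
  qed
  have "d i = 0" for i
  proof -
    have "(\<lambda>n. B * (1/2) ^ n) \<longlonglongrightarrow> B * 0" by (intro tendsto_mult tendsto_const LIMSEQ_realpow_zero) auto
    hence "\<bar>d i\<bar> \<le> B * 0" by (rule LIMSEQ_le_const) (use pow in auto)
    thus ?thesis by simp
  qed
  thus ?thesis by (auto simp: d_def fun_eq_iff)
qed

lemma sum_blocks_eq:
  fixes y :: "nat \<Rightarrow> nat \<Rightarrow> real"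
  assumes "strict_mono a" "k < n" "i \<in> {a k..<a (Suc k)}"
  shows "(\<Sum>l<n. restr {a l..<a (Suc l)} (y l) i) = y k i"
proof -
  have "restr {a l..<a (Suc l)} (y l) i = 0" if "l \<noteq> k" for l
  proof (rule ccontr)
    assume "restr {a l..<a (Suc l)} (y l) i \<noteq> 0"
    \<comment> \<open>\<open>y k i\<close> itself may be 0, so disjointness of supports is applied
      to the constant 1 instead.\<close>
    hence "restr {a l..<a (Suc l)} ((\<lambda>_ _. 1) l) i \<noteq> (0::real)" "restr {a k..<a (Suc k)} ((\<lambda>_ _. 1) k) i \<noteq> (0::real)"
      using assms(3) by (auto simp: restr_def split: if_splits)
    thus False
      using disjoint_supports_blocks[OF assms(1), of "\<lambda>_ _. 1"] that unfolding disjoint_supports_def by blast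
  qed
  hence "(\<Sum>l<n. restr {a l..<a (Suc l)} (y l) i) = (\<Sum>l\<in>{k}. restr {a l..<a (Suc l)} (y l) i)"
    using assms(2) by (intro sum.mono_neutral_right) auto
  thus ?thesis using assms(3) by (simp add: restr_def)
qed

context lorentz_weight
begin

text \<open>Sampling \<open>T (U \<alpha>)\<close> at the coordinates \<open>m k\<close> and
  dividing by the values there gives (I + E) \<alpha>, where E comes from the errors alone.
  \<open>R\<close> samples in the same way and then solves this equation.\<close>

lemma near_block_left_inverse:
  assumes T: "mod_op w w p T" and a: "strict_mono a"
    and u: "near_blocks w p a u c" "\<And>k. mod_le w p (u k) M"
    and Tu: "near_blocks w p a (\<lambda>k. T (u k)) ((\<eta>/2) powr p)"
    and "0 < \<eta>" and big: "\<And>k. \<exists>m. \<eta> \<le> \<bar>T (u k) m\<bar>"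
  obtains U R where "mod_op (\<lambda>_. 1) w p U" "mod_op w w p R"
    "\<And>\<alpha>. \<alpha> \<in> mod_space (\<lambda>_. 1) p \<Longrightarrow> R (T (U \<alpha>)) = \<alpha>"
proof -
  interpret one: lorentz_weight "\<lambda>_. 1" p by (rule lorentz_weight_one[OF p_ge_1])
  \<comment> \<open>With this budget the absolute errors at any coordinate sum to at most \<eta>/2.
    That forces the large coordinate \<open>m k\<close> into block \<open>k\<close>, and after
    division by \<bar>d k\<bar> \<ge> \<eta> it gives kernel rows of sum at most 1/2.\<close>
  define c' where "c' = (\<eta>/2) powr p"
  obtain m where m: "\<And>k. \<eta> \<le> \<bar>T (u k) (m k)\<bar>" using big by metis
  define d where "d k = T (u k) (m k)" for k
  have d: "\<eta> \<le> \<bar>d k\<bar>" "d k \<noteq> 0" for k using m[of k] \<open>0 < \<eta>\<close> by (auto simp: d_def)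
  define err where "err = block_err a (\<lambda>k. T (u k))"
  have err_sum: "(\<Sum>k<n. \<bar>err k i\<bar>) \<le> \<eta>/2" for n i
    using near_blocks_abs_err[OF Tu] p_pos \<open>0 < \<eta>\<close> by (simp add: err_def powr_powr)
  have m_block: "m k \<in> {a k..<a (Suc k)}" for k
  proof (rule ccontr)
    assume "m k \<notin> {a k..<a (Suc k)}"
    hence "err k (m k) = T (u k) (m k)" by (auto simp: err_def block_err_def restr_def)
    moreover have "\<bar>err k (m k)\<bar> \<le> (\<Sum>l<Suc k. \<bar>err l (m k)\<bar>)" by (intro member_le_sum) auto
    ultimately show False using m[of k] err_sum[where n = "Suc k" and i = "m k"] \<open>0 < \<eta>\<close> by linarith
  qed
  have "inj m"
  proof (rule injI)
    fix k l assume "m k = m l"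
    with m_block[of k] m_block[of l] have "a k < a (Suc l)" "a l < a (Suc k)" by auto
    hence "k < Suc l" "l < Suc k" using a by (simp_all add: strict_mono_less)
    thus "k = l" by simp
  qed
  define e where "e k i = err i (m k) / d k" for k i
  have e_sum: "(\<Sum>i<n. \<bar>e k i\<bar>) \<le> 1/2" for n k
  proof -
    have "(\<Sum>i<n. \<bar>e k i\<bar>) = (\<Sum>i<n. \<bar>err i (m k)\<bar>) / \<bar>d k\<bar>"
      by (simp add: e_def sum_divide_distrib)
    also have "\<dots> \<le> (\<eta>/2) / \<eta>"
      using err_sum[of _ n] d(1)[of k] \<open>0 < \<eta>\<close> by (intro frac_le) auto
    finally show ?thesis using \<open>0 < \<eta>\<close> by simp
  qed
  define b :: "(nat \<Rightarrow> real) \<Rightarrow> nat \<Rightarrow> real" where "b = (\<lambda>y k. y (m k) / d k)"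
  have b_mod: "mod_le w p (b y) (M' / \<eta> powr p)" if "mod_le w p y M'" for y M'
  proof (rule mod_le_mono)
    show "mod_le w p (\<lambda>k. 1/\<eta> * y (m k)) (\<bar>1/\<eta>\<bar> powr p * M')"
      by (rule mod_le_scale[OF mod_le_comp[OF that \<open>inj m\<close>]])
    show "\<bar>b y k\<bar> \<le> \<bar>1/\<eta> * y (m k)\<bar>" for k
      using d[of k] \<open>0 < \<eta>\<close> by (simp add: b_def abs_mult frac_le)
    show "\<bar>1/\<eta>\<bar> powr p * M' \<le> M' / \<eta> powr p"
      using \<open>0 < \<eta>\<close> by (simp add: powr_divide)
  qed
  \<comment> \<open>The chosen solution is unique by \<open>solves_unique\<close>; through
    \<open>R_eqI\<close> this yields additivity, homogeneity and the left inverse property.\<close>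
  define R where "R y = (SOME x. solves e (b y) x)" for y
  have R_eqI: "R y = x" if "solves e (b y) x" for x y
    unfolding R_def
    by (rule solves_unique[of e, OF e_sum someI[of "solves e (b y)", OF that] that])
  have R_bound: "solves e (b y) (R y)"
    "mod_le w p (R y) (2 powr p * (1 + c' * 2 powr p / \<eta> powr p) / \<eta> powr p * M')"
    if y: "mod_le w p y M'" for y M'
  proof -
    define \<beta> where "\<beta> = (M' / \<eta> powr p) powr (1/p)"
    have M': "0 \<le> M'" using mod_le_nonneg[OF y] .
    have \<beta>: "\<beta> powr p = M' / \<eta> powr p" using p_pos M' by (simp add: \<beta>_def powr_powr)
    have "0 \<le> \<beta>" by (simp add: \<beta>_def)
    have "\<bar>b y k\<bar> \<le> \<beta>" for k using mod_le_point[OF b_mod[OF y]] by (simp add: \<beta>_def)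
    then obtain x where x: "solves e (b y) x" "\<And>k. \<bar>x k\<bar> \<le> 2 * \<beta>"
      using solves_exists[of e "b y" \<beta>] e_sum by blast
    have "R y = x" using x(1) by (rule R_eqI)
    with x show "solves e (b y) (R y)" by simp
    let ?S = "2 powr p * (M' / \<eta> powr p)"
    have S: "\<bar>x k\<bar> powr p \<le> ?S" for k
    proof -
      have "\<bar>x k\<bar> powr p \<le> (2 * \<beta>) powr p" using x(2) p_pos by (intro powr_mono2) auto
      thus ?thesis using \<open>0 \<le> \<beta>\<close> by (simp add: powr_mult \<beta>)
    qed
    \<comment> \<open>\<open>x\<close> is known only to be bounded, but the error sums need no more.
      Hence E x, and with it x = b y - E x, has modulus controlled by that of
      \<open>y\<close>.\<close>
    have fin: "mod_le w p (\<lambda>k. \<Sum>i<n. x i * e k i) (c' * ?S / \<eta> powr p)" for n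
    proof -
      have "mod_le w p (\<lambda>j. \<Sum>i<n. x i * err i j) (c' * ?S)"
        using S M' unfolding err_def c'_def by (intro near_blocks_err_sum[OF Tu]) auto
      from b_mod[OF this] show ?thesis by (simp add: b_def e_def sum_divide_distrib)
    qed
    have "mod_le w p (\<lambda>k. \<Sum>i. x i * e k i) (c' * ?S / \<eta> powr p)"
    proof (rule mod_le_limit)
      show "mod_le w p (\<lambda>k. \<Sum>i<n. x i * e k i) (c' * ?S / \<eta> powr p)" for n by (rule fin)
      show "(\<lambda>n. \<Sum>i<n. x i * e k i) \<longlonglongrightarrow> (\<Sum>i. x i * e k i)" for k
        by (intro summable_LIMSEQ summable_kernel_row(1)[of e _ "1/2" x "2 * \<beta>"] e_sum x(2))
    qed
    from mod_le_diff[OF b_mod[OF y] this]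
    have "mod_le w p (\<lambda>k. b y k - (\<Sum>i. x i * e k i)) (2 powr p * (M' / \<eta> powr p + c' * ?S / \<eta> powr p))" .
    moreover have "x = (\<lambda>k. b y k - (\<Sum>i. x i * e k i))"
      using x(1) unfolding solves_def fun_eq_iff by (metis add_diff_cancel_right')
    moreover have "2 powr p * (M' / \<eta> powr p + c' * ?S / \<eta> powr p)
        = 2 powr p * (1 + c' * 2 powr p / \<eta> powr p) / \<eta> powr p * M'"
      by (simp add: algebra_simps add_divide_distrib)
    ultimately show "mod_le w p (R y) (2 powr p * (1 + c' * 2 powr p / \<eta> powr p) / \<eta> powr p * M')"
      using \<open>R y = x\<close> by metis
  qed
  show ?thesis
  proof (rule that[of "synth u" R])
    show "mod_op (\<lambda>_. 1) w p (synth u)" by (rule synth_mod_op[OF a u])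
    have sol: "solves e (b y) (R y)" if "y \<in> mod_space w p" for y
      using R_bound(1) that by (auto simp: mod_space_def)
    show "mod_op w w p R"
    proof (rule mod_opI[OF _ _ _ R_bound(2)])
      fix x y assume "x \<in> mod_space w p" "y \<in> mod_space w p"
      from solves_add[OF e_sum sol[OF this(1)] sol[OF this(2)]]
      show "R (\<lambda>n. x n + y n) = (\<lambda>n. R x n + R y n)"
        by (intro R_eqI) (simp add: b_def add_divide_distrib)
    next
      fix x r assume "x \<in> mod_space w p"
      from solves_scale[OF e_sum sol[OF this], of r]
      show "R (\<lambda>n. r * x n) = (\<lambda>n. r * R x n)"
        by (intro R_eqI) (simp add: b_def)
    qed (simp add: c'_def)
  next
    fix \<alpha> assume "\<alpha> \<in> mod_space (\<lambda>_. 1) p"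
    then obtain Q where \<alpha>: "mod_le (\<lambda>_. 1) p \<alpha> Q" by (auto simp: mod_space_def)
    show "R (T (synth u \<alpha>)) = \<alpha>"
    proof (rule R_eqI)
      have "\<alpha> k + (\<Sum>i. \<alpha> i * e k i) = b (T (synth u \<alpha>)) k" for k
      proof -
        have "(\<lambda>i. \<alpha> i * T (u i) (m k) / d k) sums b (T (synth u \<alpha>)) k"
          unfolding b_def
          by (intro sums_divide mod_op_synth_sums[OF a u lorentz_weight_axioms T \<alpha>])
        \<comment> \<open>\<open>m k\<close> lies in block \<open>k\<close> and in no other: the
          diagonal term has no error and equals \<open>\<alpha> k\<close>, while off the diagonal
          \<open>T (u i)\<close> at \<open>m k\<close> is all error.\<close>
        moreover have "\<alpha> i * T (u i) (m k) / d k = (if i = k then \<alpha> i else 0) + \<alpha> i * e k i" for i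
        proof (cases "i = k")
          case True
          have "err k (m k) = 0" using m_block[of k] by (simp add: err_def block_err_def restr_def)
          with True d(2)[of k] show ?thesis by (simp add: e_def d_def)
        next
          case False
          have "m k \<notin> {a i..<a (Suc i)}"
          proof
            assume "m k \<in> {a i..<a (Suc i)}"
            with m_block[of k] have "a k < a (Suc i)" "a i < a (Suc k)" by auto
            hence "k < Suc i" "i < Suc k" using a by (simp_all add: strict_mono_less)
            with False show False by simp
          qed
          with False show ?thesis by (simp add: e_def err_def block_err_def restr_def)
        qed
        moreover have "(\<lambda>i. (if i = k then \<alpha> i else 0) + \<alpha> i * e k i) sums (\<alpha> k + (\<Sum>i. \<alpha> i * e k i))"
          by (intro sums_add sums_single summable_sums
                summable_kernel_row(1)[of e k "1/2" \<alpha> "Q powr (1/p)"] e_sum one.mod_le_point[OF \<alpha>])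
        ultimately show ?thesis using sums_unique2 by fastforce
      qed
      thus "solves e (b (T (synth u \<alpha>))) \<alpha>"
        unfolding solves_def using one.mod_le_point[OF \<alpha>] by blast
    qed
  qed
qed

end

section \<open>Sup norms of images under operators factoring through the formal identity\<close>

context lorentz_weight
begin

text \<open>Flatness lets one drop the indices below \<open>a k\<close> and the weights with index below \<open>a k\<close> at
  the cost of \<open>\<delta>/2\<close>; then different blocks use different weights and their sums can be glued.\<close>
lemma flat_blocks_lower:
  assumes a: "strict_mono a"
    and ex: "\<And>k. \<exists>F \<sigma>. F \<subseteq> {..<a (Suc k)} \<and> \<sigma> ` F \<subseteq> {..<a (Suc k)} \<and> inj_on \<sigma> F \<and>
        \<delta> \<le> (\<Sum>i\<in>F. w (\<sigma> i) * \<bar>y k i\<bar> powr p)"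
    and flat: "\<And>k i. 2 * real (a k) * \<bar>y k i\<bar> powr p \<le> \<delta>/2"
    and g: "mod_le w p (\<lambda>i. \<Sum>k<n. restr {a k..<a (Suc k)} (y k) i) M"
  shows "n * (\<delta>/2) \<le> M"
proof -
  define g where "g i = (\<Sum>k<n. restr {a k..<a (Suc k)} (y k) i)" for i
  \<comment> \<open>Keeping indices and weights below \<open>a j\<close> leaves everything from
    \<open>a j\<close> on free for the next block.\<close>
  have "\<exists>F \<sigma>. F \<subseteq> {..<a j} \<and> \<sigma> ` F \<subseteq> {..<a j} \<and> inj_on \<sigma> F \<and>
      j * (\<delta>/2) \<le> (\<Sum>i\<in>F. w (\<sigma> i) * \<bar>g i\<bar> powr p)" if "j \<le> n" for j
    using that
  proof (induction j)
    case 0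
    show ?case by (intro exI[of _ "{}"]) auto
  next
    case (Suc j)
    then obtain F \<sigma> where F: "F \<subseteq> {..<a j}" "\<sigma> ` F \<subseteq> {..<a j}" "inj_on \<sigma> F"
      "j * (\<delta>/2) \<le> (\<Sum>i\<in>F. w (\<sigma> i) * \<bar>g i\<bar> powr p)" by auto
    obtain H \<tau> where H: "H \<subseteq> {..<a (Suc j)}" "\<tau> ` H \<subseteq> {..<a (Suc j)}" "inj_on \<tau> H"
      "\<delta> \<le> (\<Sum>i\<in>H. w (\<tau> i) * \<bar>y j i\<bar> powr p)" using ex[of j] by auto
    define H' where "H' = {i\<in>H. a j \<le> i \<and> a j \<le> \<tau> i}"
    define B where "B = H \<inter> {..<a j} \<union> {i\<in>H. \<tau> i < a j}"
    have fin: "finite H" "finite F" using H(1) F(1) finite_subset by blast+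
    hence fin': "finite H'" "finite B" by (auto simp: H'_def B_def)
    have "card (\<tau> ` {i\<in>H. \<tau> i < a j}) \<le> card {..<a j}" by (intro card_mono) auto
    moreover have "card (\<tau> ` {i\<in>H. \<tau> i < a j}) = card {i\<in>H. \<tau> i < a j}"
      using H(3) by (intro card_image) (auto simp: inj_on_def)
    moreover have "card (H \<inter> {..<a j}) \<le> card {..<a j}" by (intro card_mono) auto
    ultimately have "card B \<le> 2 * a j"
      unfolding B_def using card_Un_le[of "H \<inter> {..<a j}" "{i\<in>H. \<tau> i < a j}"] by simp
    \<comment> \<open>At most 2 * \<open>a j\<close> indices are dropped, and flatness bounds each
      dropped term by \<open>s\<close>. If \<open>a j\<close> is 0, nothing is dropped; that case is
      separate because \<open>s\<close> divides by \<open>a j\<close>.\<close>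
    define s where "s = \<delta>/2 / (2 * real (a j))"
    have "(\<Sum>i\<in>B. w (\<tau> i) * \<bar>y j i\<bar> powr p) \<le> \<delta>/2"
    proof (cases "B = {}")
      case True
      show ?thesis using flat[of j 0] powr_ge_zero[of "\<bar>y j 0\<bar>" p] unfolding True
        by (smt (verit) mult_nonneg_nonneg of_nat_0_le_iff sum.empty)
    next
      case False
      hence pos: "0 < real (a j)" by (auto simp: B_def)
      have "(\<Sum>i\<in>B. w (\<tau> i) * \<bar>y j i\<bar> powr p) \<le> (\<Sum>i\<in>B. 1 * s)"
        using flat[of j] pos
        by (intro sum_mono mult_mono w_le_1) (auto simp: s_def field_simps)
      also have "\<dots> = card B * s" by simp
      also have "\<dots> \<le> (2 * real (a j)) * s"
      proof (rule mult_right_mono)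
        show "real (card B) \<le> 2 * real (a j)" using \<open>card B \<le> 2 * a j\<close> by linarith
        have "0 \<le> \<delta>/2" using flat[of j 0] pos
          by (smt (verit) mult_nonneg_nonneg powr_ge_zero)
        thus "0 \<le> s" using pos by (simp add: s_def)
      qed
      also have "\<dots> = \<delta>/2" using pos by (simp add: s_def)
      finally show ?thesis .
    qed
    moreover have "(\<Sum>i\<in>H. w (\<tau> i) * \<bar>y j i\<bar> powr p)
        = (\<Sum>i\<in>H'. w (\<tau> i) * \<bar>y j i\<bar> powr p) + (\<Sum>i\<in>B. w (\<tau> i) * \<bar>y j i\<bar> powr p)"
    proof -
      have 1: "H = H' \<union> B" and 2: "H' \<inter> B = {}" by (auto simp: H'_def B_def)
      show ?thesis unfolding 1 by (rule sum.union_disjoint[OF fin' 2])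
    qed
    ultimately have H'_sum: "\<delta>/2 \<le> (\<Sum>i\<in>H'. w (\<tau> i) * \<bar>y j i\<bar> powr p)" using H(4) by linarith
    define \<rho> where "\<rho> = (\<lambda>i. if i \<in> F then \<sigma> i else \<tau> i)"
    have disj: "i \<notin> F" if "i \<in> H'" for i
    proof
      assume "i \<in> F"
      hence "i < a j" using F(1) by blast
      thus False using that by (simp add: H'_def)
    qed
    have aj: "a j < a (Suc j)" using a by (simp add: strict_mono_less)
    show ?case
    proof (intro exI conjI)
      show "F \<union> H' \<subseteq> {..<a (Suc j)}" using F(1) H(1) aj by (auto simp: H'_def)
      show "\<rho> ` (F \<union> H') \<subseteq> {..<a (Suc j)}" using F(2) H(2) aj by (auto simp: H'_def \<rho>_def)
      show "inj_on \<rho> (F \<union> H')" unfolding \<rho>_def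
      proof (rule inj_on_disjoint_Un[OF F(3)])
        show "inj_on \<tau> H'" using H(3) by (rule inj_on_subset) (auto simp: H'_def)
        show "\<sigma> ` F \<inter> \<tau> ` H' = {}"
        proof (rule equals0I)
          fix l assume "l \<in> \<sigma> ` F \<inter> \<tau> ` H'"
          hence "l < a j" "a j \<le> l" using F(2) by (auto simp: H'_def)
          thus False by simp
        qed
      qed
      have "(\<Sum>i\<in>F \<union> H'. w (\<rho> i) * \<bar>g i\<bar> powr p)
          = (\<Sum>i\<in>F. w (\<rho> i) * \<bar>g i\<bar> powr p) + (\<Sum>i\<in>H'. w (\<rho> i) * \<bar>g i\<bar> powr p)"
        using fin fin' disj by (intro sum.union_disjoint) auto
      also have "(\<Sum>i\<in>F. w (\<rho> i) * \<bar>g i\<bar> powr p) = (\<Sum>i\<in>F. w (\<sigma> i) * \<bar>g i\<bar> powr p)"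
        by (simp add: \<rho>_def)
      also have "(\<Sum>i\<in>H'. w (\<rho> i) * \<bar>g i\<bar> powr p) = (\<Sum>i\<in>H'. w (\<tau> i) * \<bar>y j i\<bar> powr p)"
      proof (rule sum.cong)
        fix i assume i: "i \<in> H'"
        have "i \<in> {a j..<a (Suc j)}" using i H(1) by (auto simp: H'_def)
        from sum_blocks_eq[OF a _ this, of n y] have "g i = y j i" using Suc.prems by (simp add: g_def)
        thus "w (\<rho> i) * \<bar>g i\<bar> powr p = w (\<tau> i) * \<bar>y j i\<bar> powr p" using disj[OF i] by (simp add: \<rho>_def)
      qed simp
      finally show "Suc j * (\<delta>/2) \<le> (\<Sum>i\<in>F \<union> H'. w (\<rho> i) * \<bar>g i\<bar> powr p)"
        using F(4) H'_sum by (simp add: distrib_right)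
    qed
  qed
  from this[of n] obtain F \<sigma> where F: "F \<subseteq> {..<a n}" "inj_on \<sigma> F"
    "n * (\<delta>/2) \<le> (\<Sum>i\<in>F. w (\<sigma> i) * \<bar>g i\<bar> powr p)" by auto
  have "finite F" using F(1) finite_subset by blast
  from mod_leD[OF g this F(2)] F(3) show ?thesis by (simp add: g_def)
qed

text \<open>Boundedness of the formal identity j, since weights are at most 1.\<close>

lemma mod_le_of_lp:
  assumes "mod_le (\<lambda>_. 1) p x Q"
  shows "mod_le w p x Q"
proof (rule mod_leI)
  fix F :: "nat set" and \<sigma> :: "nat \<Rightarrow> nat"
  assume F: "finite F" "inj_on \<sigma> F"
  have "(\<Sum>i\<in>F. w (\<sigma> i) * \<bar>x i\<bar> powr p) \<le> (\<Sum>i\<in>F. 1 * \<bar>x i\<bar> powr p)"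
    by (intro sum_mono mult_right_mono w_le_1) auto
  also have "\<dots> \<le> Q" by (rule mod_leD[OF assms F])
  finally show "(\<Sum>i\<in>F. w (\<sigma> i) * \<bar>x i\<bar> powr p) \<le> Q" .
qed

text \<open>If the sup norms of \<open>A (z k)\<close> tended to \<open>0\<close>, sums of \<open>n\<close> almost disjoint terms \<open>A (z k)\<close> would
  have modulus at least a multiple of \<open>n\<close>.  But the corresponding sums of the \<open>z k\<close> have uniformly
  bounded coordinates and \<open>\<ell>\<^sub>p\<close>-modulus \<open>O(n)\<close>, so by interpolation their Lorentz modulus is
  \<open>o(n)\<close>.\<close>
lemma sup_norm_not_null:
  assumes wlim: "w \<longlonglongrightarrow> 0" and A: "mod_op w w p A"
    and z: "\<And>k. mod_le (\<lambda>_. 1) p (z k) M" "\<And>i. (\<lambda>k. z k i) \<longlonglongrightarrow> 0"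
    and Az: "\<And>i. (\<lambda>k. A (z k) i) \<longlonglongrightarrow> 0" "\<And>k. \<not> mod_le w p (A (z k)) \<delta>" and "0 < \<delta>"
  shows "\<exists>\<eta>>0. \<exists>\<^sub>F k in sequentially. \<exists>m. \<eta> \<le> \<bar>A (z k) m\<bar>"
proof (rule ccontr)
  interpret one: lorentz_weight "\<lambda>_. 1" p by (rule lorentz_weight_one[OF p_ge_1])
  assume "\<not> ?thesis"
  hence small: "\<forall>\<^sub>F k in sequentially. \<forall>m. \<bar>A (z k) m\<bar> < \<eta>" if "0 < \<eta>" for \<eta>
    using that by (auto simp: not_frequently not_le)
  obtain C where C: "0 \<le> C" "\<And>x M. mod_le w p x M \<Longrightarrow> mod_le w p (A x) (C * M)"
    using mod_op_bounded[OF A] by blast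
  have Az_mod: "mod_le w p (A (z k)) (C * M)" for k by (intro C mod_le_of_lp z)
  \<comment> \<open>That the modulus exceeds \<delta> is witnessed by a finite sum, so its indices
    and weights fit below some cut point.\<close>
  define large where "large a x \<longleftrightarrow> (\<exists>F \<sigma>. F \<subseteq> {..<a} \<and> \<sigma> ` F \<subseteq> {..<a} \<and> inj_on \<sigma> F \<and>
        \<delta> \<le> (\<Sum>i\<in>F. w (\<sigma> i) * \<bar>x i\<bar> powr p))" for a and x :: "nat \<Rightarrow> real"
  have ev_large: "\<forall>\<^sub>F a in sequentially. large a (A (z k))" for k
  proof -
    from Az(2)[of k] obtain F \<sigma> where F: "finite F" "inj_on \<sigma> F"
      "\<delta> < (\<Sum>i\<in>F. w (\<sigma> i) * \<bar>A (z k) i\<bar> powr p)" by (auto simp: mod_le_def not_le)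
    obtain N where N: "\<forall>i\<in>F \<union> \<sigma> ` F. i < N"
      using F(1) finite_nat_set_iff_bounded[of "F \<union> \<sigma> ` F"] by auto
    have "large a (A (z k))" if "N \<le> a" for a
    proof -
      have "\<forall>i\<in>F \<union> \<sigma> ` F. i < a" using N that by (meson less_le_trans)
      hence "F \<subseteq> {..<a}" "\<sigma> ` F \<subseteq> {..<a}" by auto
      thus ?thesis unfolding large_def using F by (intro exI[of _ F] exI[of _ \<sigma>]) auto
    qed
    thus ?thesis by (auto simp: eventually_at_top_linorder)
  qed
  have ev_flat: "\<forall>\<^sub>F k in sequentially. \<forall>i. 2 * real a * \<bar>A (z k) i\<bar> powr p \<le> \<delta>/2" for a
  proof -
    define \<eta> where "\<eta> = (\<delta> / (4 * (real a + 1))) powr (1/p)"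
    have \<eta>: "0 < \<eta>" "\<eta> powr p = \<delta> / (4 * (real a + 1))"
      using \<open>0 < \<delta>\<close> p_pos by (simp_all add: \<eta>_def powr_powr)
    show ?thesis using small[OF \<eta>(1)]
    proof eventually_elim
      case (elim k)
      show ?case
      proof
        fix i
        have "\<bar>A (z k) i\<bar> powr p \<le> \<eta> powr p"
          using elim p_pos by (intro powr_mono2) (auto intro: less_imp_le)
        hence "2 * real a * \<bar>A (z k) i\<bar> powr p \<le> 2 * (real a + 1) * \<eta> powr p"
          by (intro mult_mono) auto
        also have "\<dots> = \<delta>/2" unfolding \<eta>(2) by (simp add: field_simps)
        finally show "2 * real a * \<bar>A (z k) i\<bar> powr p \<le> \<delta>/2" .
      qed
    qed
  qed
  have tol: "0 < block_tol p 1 k" for k by (rule block_tol_pos) simp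
  \<comment> \<open>The preimages in l_p and their images are cut at the same points. Flatness
    belongs to \<open>Q\<close>, as it is relative to the cut preceding the vector.\<close>
  define P where "P k r a \<longleftrightarrow> mod_le (\<lambda>_. 1) p (restr {a..} (z r)) (block_tol p 1 k) \<and>
      mod_le w p (restr {a..} (A (z r))) (block_tol p 1 k) \<and> large a (A (z r))" for k r a
  define Q where "Q k a r \<longleftrightarrow> mod_le (\<lambda>_. 1) p (restr {..<a} (z r)) (block_tol p 1 k) \<and>
      mod_le w p (restr {..<a} (A (z r))) (block_tol p 1 k) \<and>
      (\<forall>i. 2 * real a * \<bar>A (z r) i\<bar> powr p \<le> \<delta>/2)" for k a r
  have "\<forall>\<^sub>F a in sequentially. P k r a" for k r
    unfolding P_def
    by (intro eventually_conj one.eventually_mod_le_tail[OF z(1) tol]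
          eventually_mod_le_tail[OF Az_mod tol] ev_large)
  moreover have "\<forall>\<^sub>F r in sequentially. Q k a r" for k a
    unfolding Q_def
    by (intro eventually_conj one.eventually_mod_le_head[OF z(2) tol]
          eventually_mod_le_head[OF Az(1) tol] ev_flat)
  ultimately obtain r a :: "nat \<Rightarrow> nat" where ra: "strict_mono r" "strict_mono a"
    "\<And>k. Q k (a k) (r k)" "\<And>k. P k (r k) (a (Suc k))"
    using alternating_choice[of P Q] by blast
  have nb_z: "near_blocks (\<lambda>_. 1) p a (\<lambda>k. z (r k)) 1"
    using ra(3,4) by (intro one.near_blocksI) (auto simp: P_def Q_def)
  have nb_Az: "near_blocks w p a (\<lambda>k. A (z (r k))) 1"
    using ra(3,4) by (intro near_blocksI) (auto simp: P_def Q_def)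
  \<comment> \<open>Bounds both the p-th powers of the coordinates of a sum (one block entry, at
    most M, plus errors, at most 1) and its l_p modulus per summand.\<close>
  define K where "K = 2 powr p * (M + 1)"
  have "0 \<le> M" using one.mod_le_nonneg[OF z(1)] .
  have main: "n * (\<delta>/2) \<le> 2 powr p * (C * (L * K + w L * (K * n)) + 1)" for n L :: nat
  proof -
    define s where "s = (\<lambda>i. \<Sum>k<n. 1 * z (r k) i)"
    have s_lp: "mod_le (\<lambda>_. 1) p s (K * n)"
      using one.near_blocks_sum[OF ra(2) nb_z z(1), where n = n and \<alpha> = "\<lambda>_. 1"]
      by (simp add: s_def K_def)
    have s_sup: "\<bar>s i\<bar> powr p \<le> K" for i
    proof -
      define v where "v = (\<Sum>k<n. 1 * restr {a k..<a (Suc k)} (z (r k)) i)"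
      define t where "t = (\<Sum>k<n. 1 * block_err a (\<lambda>k. z (r k)) k i)"
      have "s i = v + t" unfolding s_def v_def t_def by (rule sum_blocks_plus_err)
      moreover have "\<bar>v\<bar> powr p \<le> M"
        unfolding v_def mult_1
      proof (cases rule: disjoint_supports_sum_cases[OF disjoint_supports_blocks[OF ra(2)],
            where n = n and i = i and y1 = "\<lambda>k. z (r k)"])
        case 1
        thus "\<bar>\<Sum>k<n. restr {a k..<a (Suc k)} (z (r k)) i\<bar> powr p \<le> M" using \<open>0 \<le> M\<close> by simp
      next
        case (2 k)
        thus "\<bar>\<Sum>k<n. restr {a k..<a (Suc k)} (z (r k)) i\<bar> powr p \<le> M"
          using one.mod_le_powr_point[OF one.mod_le_restr[OF z(1)]] by simp
      qed
      moreover have "mod_le (\<lambda>_. 1) p (\<lambda>i. \<Sum>k<n. 1 * block_err a (\<lambda>k. z (r k)) k i) (1 * 1)"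
        by (rule one.near_blocks_err_sum[OF nb_z]) auto
      hence "\<bar>t\<bar> powr p \<le> 1" using one.mod_le_powr_point unfolding t_def by fastforce
      moreover have "\<bar>v + t\<bar> powr p \<le> (\<bar>v\<bar> + \<bar>t\<bar>) powr p"
        using p_pos by (intro powr_mono2) auto
      moreover have "(\<bar>v\<bar> + \<bar>t\<bar>) powr p \<le> 2 powr p * (\<bar>v\<bar> powr p + \<bar>t\<bar> powr p)"
        using p_pos by (intro powr_add_le) auto
      moreover have "2 powr p * (\<bar>v\<bar> powr p + \<bar>t\<bar> powr p) \<le> K"
        using calculation(2,3) unfolding K_def by (intro mult_left_mono add_mono) auto
      ultimately show ?thesis by simp
    qed
    have As: "A s = (\<lambda>i. \<Sum>k<n. 1 * A (z (r k)) i)"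
      unfolding s_def by (intro mod_op_sum[OF A] mod_spaceI[OF mod_le_of_lp[OF z(1)]])
    have 1: "mod_le w p (A s) (C * (L * K + w L * (K * n)))"
      by (intro C mod_le_interpolate s_lp s_sup)
    have 2: "mod_le w p (\<lambda>i. \<Sum>k<n. 1 * block_err a (\<lambda>k. A (z (r k))) k i) (1 * 1)"
      by (rule near_blocks_err_sum[OF nb_Az]) auto
    have "(\<Sum>k<n. restr {a k..<a (Suc k)} (A (z (r k))) i)
        = A s i - (\<Sum>k<n. 1 * block_err a (\<lambda>k. A (z (r k))) k i)" for i
      unfolding As using sum_blocks_plus_err[of "\<lambda>_. 1" "\<lambda>k. A (z (r k))" i n a] by simp
    with mod_le_diff[OF 1 2]
    have "mod_le w p (\<lambda>i. \<Sum>k<n. restr {a k..<a (Suc k)} (A (z (r k))) i)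
        (2 powr p * (C * (L * K + w L * (K * n)) + 1))" by simp
    thus ?thesis
    proof (rule flat_blocks_lower[OF ra(2), rotated 2])
      show "\<exists>F \<sigma>. F \<subseteq> {..<a (Suc k)} \<and> \<sigma> ` F \<subseteq> {..<a (Suc k)} \<and> inj_on \<sigma> F \<and>
          \<delta> \<le> (\<Sum>i\<in>F. w (\<sigma> i) * \<bar>A (z (r k)) i\<bar> powr p)" for k
        using ra(4)[of k] unfolding P_def large_def by blast
      show "2 * real (a k) * \<bar>A (z (r k)) i\<bar> powr p \<le> \<delta>/2" for k i
        using ra(3)[of k] unfolding Q_def by blast
    qed
  qed
  \<comment> \<open>\<open>L\<close> is fixed first, making the slope in n at most \<delta>/4. The
    rest \<open>E\<close> does not depend on n, so a large n contradicts growth with slope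
    \<delta>/2.\<close>
  define c where "c = 2 powr p * C * K"
  have "(\<lambda>L. c * w L) \<longlonglongrightarrow> c * 0" by (intro tendsto_mult tendsto_const wlim)
  hence "\<forall>\<^sub>F L in sequentially. c * w L < \<delta>/4"
    using \<open>0 < \<delta>\<close> by (intro order_tendstoD) auto
  then obtain L where L: "c * w L < \<delta>/4" by (auto simp: eventually_at_top_linorder)
  define E where "E = c * L + 2 powr p"
  obtain n :: nat where n: "E / (\<delta>/4) < n" using reals_Archimedean2 by blast
  have "n * (\<delta>/2) \<le> c * L + c * w L * n + 2 powr p"
    using main[of n L] by (simp add: c_def algebra_simps)
  also have "\<dots> \<le> E + \<delta>/4 * n"
    using mult_right_mono[OF less_imp_le[OF L], of "real n"] by (simp add: E_def)
  finally have "n * (\<delta>/4) \<le> E" by (simp add: algebra_simps)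
  with n \<open>0 < \<delta>\<close> show False by (simp add: field_simps)
qed

end

section \<open>Factorization of the formal identity through non-compact operators\<close>

lemma frequently_subsequence:
  fixes P :: "nat \<Rightarrow> bool"
  assumes "\<exists>\<^sub>F n in sequentially. P n"
  obtains r :: "nat \<Rightarrow> nat" where "strict_mono r" "\<And>n. P (r n)"
  using assms not_eventually_sequentiallyD[of "\<lambda>n. \<not> P n"] unfolding frequently_def by auto

lemma tendsto_diff_subsequences:
  fixes X :: "nat \<Rightarrow> real"
  assumes "convergent X" "strict_mono n" "\<And>j. n j < l j"
  shows "(\<lambda>j. X (n j) - X (l j)) \<longlonglongrightarrow> 0"
proof -
  obtain L where L: "X \<longlonglongrightarrow> L" using assms(1) by (auto simp: convergent_def)
  have n: "filterlim n at_top sequentially" using assms(2) by (rule filterlim_subseq)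
  have "filterlim l at_top sequentially"
    using n by (rule filterlim_at_top_mono) (use assms(3) in \<open>auto intro!: always_eventually less_imp_le\<close>)
  from tendsto_diff[OF filterlim_compose[OF L n] filterlim_compose[OF L this]]
  show ?thesis by simp
qed

lemma bounded_convergent_subsequence:
  fixes f :: "nat \<Rightarrow> nat \<Rightarrow> real"
  assumes "\<And>n i. \<bar>f n i\<bar> \<le> K"
  obtains r :: "nat \<Rightarrow> nat" where "strict_mono r" "\<And>i. convergent (\<lambda>n. f (r n) i)"
  using function_convergent_subsequence[of UNIV f K] assms unfolding convergent_def by auto

context lorentz_weight
begin

text \<open>Differences of terms of one sequence are used, not differences from its coordinatewise
  limit: \<open>B\<close> and \<open>T\<close> need not commute with such limits, but differences
  are null for vectors and images alike once all three converge coordinatewise.\<close>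

lemma noncompact_null_sequence:
  assumes T: "mod_op w w p T" and B: "mod_op w (\<lambda>_. 1) p B" and xs: "\<And>k. mod_le w p (xs k) M"
    and noncompact: "\<And>(r :: nat \<Rightarrow> nat) y. strict_mono r \<Longrightarrow> y \<in> mod_space w p \<Longrightarrow>
      \<exists>\<epsilon>>0. \<exists>\<^sub>F k in sequentially. \<not> mod_le w p (\<lambda>n. T (xs (r k)) n - y n) \<epsilon>"
  obtains u M' \<delta> where "\<And>k. mod_le w p (u k) M'" "\<And>i. (\<lambda>k. u k i) \<longlonglongrightarrow> 0"
    "\<And>i. (\<lambda>k. B (u k) i) \<longlonglongrightarrow> 0" "\<And>i. (\<lambda>k. T (u k) i) \<longlonglongrightarrow> 0"
    "0 < \<delta>" "\<And>k. \<not> mod_le w p (T (u k)) \<delta>"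
proof -
  interpret one: lorentz_weight "\<lambda>_. 1" p by (rule lorentz_weight_one[OF p_ge_1])
  obtain C where C: "0 \<le> C" "\<And>x M. mod_le w p x M \<Longrightarrow> mod_le w p (T x) (C * M)"
    using mod_op_bounded[OF T] by blast
  obtain D where D: "0 \<le> D" "\<And>x M. mod_le w p x M \<Longrightarrow> mod_le (\<lambda>_. 1) p (B x) (D * M)"
    using mod_op_bounded[OF B] by blast
  obtain r1 :: "nat \<Rightarrow> nat" where r1: "strict_mono r1" "\<And>i. convergent (\<lambda>n. xs (r1 n) i)"
    by (rule bounded_convergent_subsequence[of xs, OF mod_le_point[OF xs]]) (rule that)
  obtain r2 :: "nat \<Rightarrow> nat" where r2: "strict_mono r2" "\<And>i. convergent (\<lambda>n. B (xs (r1 (r2 n))) i)"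
    by (rule bounded_convergent_subsequence[of "\<lambda>n. B (xs (r1 n))",
          OF one.mod_le_point[OF D(2)[OF xs]]]) (rule that)
  obtain r3 :: "nat \<Rightarrow> nat" where r3: "strict_mono r3" "\<And>i. convergent (\<lambda>n. T (xs (r1 (r2 (r3 n)))) i)"
    by (rule bounded_convergent_subsequence[of "\<lambda>n. T (xs (r1 (r2 n)))",
          OF mod_le_point[OF C(2)[OF xs]]]) (rule that)
  define f where "f n = xs (r1 (r2 (r3 n)))" for n
  have mono: "strict_mono (\<lambda>n. r1 (r2 (r3 n)))"
    using r1(1) r2(1) r3(1) by (auto simp: strict_mono_def)
  have f: "mod_le w p (f n) M" for n by (simp add: f_def xs)
  have conv: "convergent (\<lambda>n. f n i)" "convergent (\<lambda>n. B (f n) i)" "convergent (\<lambda>n. T (f n) i)" for i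
    using convergent_subseq_convergent[OF r1(2)[of i], of "\<lambda>n. r2 (r3 n)"]
      convergent_subseq_convergent[OF r2(2)[of i] r3(1)] r3(2)[of i] r2(1) r3(1)
    by (auto simp: f_def o_def strict_mono_def)
  \<comment> \<open>The only candidate for a limit of the images; it lies in the space by the Fatou
    property, so non-compactness applies to it.\<close>
  define y where "y i = lim (\<lambda>n. T (f n) i)" for i
  have y: "(\<lambda>n. T (f n) i) \<longlonglongrightarrow> y i" for i
    using conv(3)[of i] by (simp add: y_def convergent_LIMSEQ_iff)
  have "y \<in> mod_space w p"
    using mod_le_limit[OF C(2)[OF f] y] by (rule mod_spaceI)
  then obtain \<epsilon> where \<epsilon>: "0 < \<epsilon>" "\<exists>\<^sub>F k in sequentially. \<not> mod_le w p (\<lambda>n. T (f k) n - y n) \<epsilon>"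
    using noncompact[OF mono, of y] by (auto simp: f_def)
  obtain n :: "nat \<Rightarrow> nat" where n: "strict_mono n" "\<And>j. \<not> mod_le w p (\<lambda>i. T (f (n j)) i - y i) \<epsilon>"
    using frequently_subsequence[OF \<epsilon>(2)] by blast
  \<comment> \<open>If all later images were \<epsilon>-close to the one at \<open>n j\<close>, so
    would be their coordinatewise limit \<open>y\<close>.\<close>
  have "\<exists>l>n j. \<not> mod_le w p (\<lambda>i. T (f (n j)) i - T (f l) i) \<epsilon>" for j
  proof (rule ccontr)
    assume "\<not> ?thesis"
    hence "mod_le w p (\<lambda>i. T (f (n j)) i - T (f (l + Suc (n j))) i) \<epsilon>" for l by auto
    moreover have "(\<lambda>l. T (f (n j)) i - T (f (l + Suc (n j))) i) \<longlonglongrightarrow> T (f (n j)) i - y i" for i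
      by (intro tendsto_diff tendsto_const LIMSEQ_ignore_initial_segment[OF y])
    ultimately have "mod_le w p (\<lambda>i. T (f (n j)) i - y i) \<epsilon>" by (rule mod_le_limit)
    with n(2) show False by blast
  qed
  then obtain l where l: "\<And>j. n j < l j" "\<And>j. \<not> mod_le w p (\<lambda>i. T (f (n j)) i - T (f (l j)) i) \<epsilon>"
    by metis
  define u where "u j = (\<lambda>i. f (n j) i - f (l j) i)" for j
  have Tu: "T (u j) = (\<lambda>i. T (f (n j)) i - T (f (l j)) i)" for j
    unfolding u_def by (intro mod_op_diff[OF T] mod_spaceI[OF f])
  have Bu: "B (u j) = (\<lambda>i. B (f (n j)) i - B (f (l j)) i)" for j
    unfolding u_def by (intro mod_op_diff[OF B] mod_spaceI[OF f])
  show ?thesis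
  proof (rule that[of u _ \<epsilon>])
    show "mod_le w p (u k) (2 powr p * (M + M))" for k
      unfolding u_def by (intro mod_le_diff f)
    show "(\<lambda>k. u k i) \<longlonglongrightarrow> 0" for i
      unfolding u_def by (rule tendsto_diff_subsequences[OF conv(1) n(1) l(1)])
    show "(\<lambda>k. B (u k) i) \<longlonglongrightarrow> 0" for i
      unfolding Bu by (rule tendsto_diff_subsequences[OF conv(2) n(1) l(1)])
    show "(\<lambda>k. T (u k) i) \<longlonglongrightarrow> 0" for i
      unfolding Tu by (rule tendsto_diff_subsequences[OF conv(3) n(1) l(1)])
  qed (use \<epsilon>(1) l(2) in \<open>auto simp: Tu\<close>)
qed

section \<open>Translation between norms and moduli, and assembly\<close>

lemma lorentz_norm_nonneg: "0 \<le> lorentz_norm w p x"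
  by (simp add: lorentz_norm_def)

lemma lp_norm_nonneg: "0 \<le> lp_norm p x"
  by (simp add: lp_norm_def)

lemma Lop_d_iff: "T \<in> Lop_d w p \<longleftrightarrow> mod_op w w p T"
  unfolding Lop_d_def mem_Collect_eq
  by (rule bounded_op_iff_mod_op[OF p_pos
        mod_le_lorentz_norm mod_le_in_lorentz_space lorentz_norm_powr_le
        mod_le_lorentz_norm mod_le_in_lorentz_space lorentz_norm_powr_le
        lorentz_norm_nonneg lorentz_norm_nonneg])

lemma Lop_d_lp_iff: "T \<in> Lop_d_lp w p \<longleftrightarrow> mod_op w (\<lambda>_. 1) p T"
  unfolding Lop_d_lp_def mem_Collect_eq
  by (rule bounded_op_iff_mod_op[OF p_pos
        mod_le_lorentz_norm mod_le_in_lorentz_space lorentz_norm_powr_le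
        mod_le_lp_norm[OF p_ge_1] mod_le_in_lp_space[OF p_ge_1] lp_norm_powr_le[OF p_ge_1]
        lorentz_norm_nonneg lp_norm_nonneg])

lemma lorentz_space_eq: "lorentz_space w p = mod_space w p"
  unfolding mod_space_def using lorentz_space_iff by blast

lemma not_compactE:
  assumes "\<not> compact_op_d w p T"
  obtains xs M where "\<And>k. mod_le w p (xs k) M"
    "\<And>(r :: nat \<Rightarrow> nat) y. strict_mono r \<Longrightarrow> y \<in> mod_space w p \<Longrightarrow>
      \<exists>\<epsilon>>0. \<exists>\<^sub>F k in sequentially. \<not> mod_le w p (\<lambda>n. T (xs (r k)) n - y n) \<epsilon>"
proof -
  obtain xs M where xs: "\<And>k. xs k \<in> lorentz_space w p" "\<And>k :: nat. lorentz_norm w p (xs k) \<le> M"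
    and nc: "\<And>(r :: nat \<Rightarrow> nat) y. strict_mono r \<Longrightarrow> y \<in> lorentz_space w p \<Longrightarrow>
      \<not> (\<lambda>k. lorentz_norm w p (\<lambda>n. T (xs (r k)) n - y n)) \<longlonglongrightarrow> 0"
    using assms unfolding compact_op_d_def by blast
  show ?thesis
  proof (rule that[of xs "M powr p"])
    show "mod_le w p (xs k) (M powr p)" for k
      using xs(2)[of k] p_pos lorentz_norm_nonneg
      by (intro mod_le_weaken[OF mod_le_lorentz_norm[OF xs(1)]] powr_mono2) auto
  next
    fix r :: "nat \<Rightarrow> nat" and y assume r: "strict_mono r" and y: "y \<in> mod_space w p"
    show "\<exists>\<epsilon>>0. \<exists>\<^sub>F k in sequentially. \<not> mod_le w p (\<lambda>n. T (xs (r k)) n - y n) \<epsilon>"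
    proof (rule ccontr)
      assume "\<not> ?thesis"
      hence ev: "\<forall>\<^sub>F k in sequentially. mod_le w p (\<lambda>n. T (xs (r k)) n - y n) \<epsilon>" if "0 < \<epsilon>" for \<epsilon>
        using that by (auto simp: not_frequently)
      have "(\<lambda>k. lorentz_norm w p (\<lambda>n. T (xs (r k)) n - y n)) \<longlonglongrightarrow> 0"
      proof (rule tendstoI)
        fix e :: real assume e: "0 < e"
        hence "0 < (e/2) powr p" by simp
        from ev[OF this]
        show "\<forall>\<^sub>F k in sequentially. dist (lorentz_norm w p (\<lambda>n. T (xs (r k)) n - y n)) 0 < e"
        proof eventually_elim
          case (elim k)
          let ?N = "lorentz_norm w p (\<lambda>n. T (xs (r k)) n - y n)"
          have "(?N powr p) powr (1/p) \<le> ((e/2) powr p) powr (1/p)"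
            using p_pos by (intro powr_mono2 lorentz_norm_powr_le[OF elim] powr_ge_zero) simp
          hence "?N \<le> e/2" using p_pos e lorentz_norm_nonneg by (simp add: powr_powr)
          thus ?case using e lorentz_norm_nonneg by simp
        qed
      qed
      with nc[OF r, of y] y show False by (simp add: lorentz_space_eq)
    qed
  qed
qed

lemma noncompact_left_inverse:
  assumes wlim: "w \<longlonglongrightarrow> 0" and T: "T \<in> Jj w p" "\<not> compact_op_d w p T"
  obtains U R where "mod_op (\<lambda>_. 1) w p U" "mod_op w w p R"
    "\<And>\<alpha>. \<alpha> \<in> mod_space (\<lambda>_. 1) p \<Longrightarrow> R (T (U \<alpha>)) = \<alpha>"
proof -
  obtain A B where "T \<in> Lop_d w p" "A \<in> Lop_d w p" "B \<in> Lop_d_lp w p"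
    and TAB: "\<And>x. x \<in> mod_space w p \<Longrightarrow> T x = A (B x)"
    using T(1) by (auto simp: Jj_def lorentz_space_eq)
  hence T_op: "mod_op w w p T" and A: "mod_op w w p A" and B: "mod_op w (\<lambda>_. 1) p B"
    by (simp_all add: Lop_d_iff Lop_d_lp_iff)
  obtain xs M where xs: "\<And>k. mod_le w p (xs k) M"
    "\<And>(r :: nat \<Rightarrow> nat) y. strict_mono r \<Longrightarrow> y \<in> mod_space w p \<Longrightarrow>
      \<exists>\<epsilon>>0. \<exists>\<^sub>F k in sequentially. \<not> mod_le w p (\<lambda>n. T (xs (r k)) n - y n) \<epsilon>"
    using not_compactE[OF T(2)] by blast
  obtain u M' \<delta> where u: "\<And>k. mod_le w p (u k) M'" "\<And>i. (\<lambda>k. u k i) \<longlonglongrightarrow> 0"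
    "\<And>i. (\<lambda>k. B (u k) i) \<longlonglongrightarrow> 0" "\<And>i. (\<lambda>k. T (u k) i) \<longlonglongrightarrow> 0"
    "0 < \<delta>" "\<And>k. \<not> mod_le w p (T (u k)) \<delta>"
    by (rule noncompact_null_sequence[of T B xs M, OF T_op B xs(1)]) (erule (1) xs(2), rule that)
  have Tu: "T (u k) = A (B (u k))" for k by (rule TAB[OF mod_spaceI[OF u(1)]])
  obtain D where D: "0 \<le> D" "\<And>x M. mod_le w p x M \<Longrightarrow> mod_le (\<lambda>_. 1) p (B x) (D * M)"
    using mod_op_bounded[OF B] by blast
  obtain C where C: "0 \<le> C" "\<And>x M. mod_le w p x M \<Longrightarrow> mod_le w p (T x) (C * M)"
    using mod_op_bounded[OF T_op] by blast
  have "\<exists>\<eta>>0. \<exists>\<^sub>F k in sequentially. \<exists>m. \<eta> \<le> \<bar>A (B (u k)) m\<bar>"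
    by (rule sup_norm_not_null[OF wlim A D(2)[OF u(1)] u(3) _ _ u(5)])
       (use u(4,6) in \<open>simp_all add: Tu\<close>)
  then obtain \<eta> where \<eta>: "0 < \<eta>" "\<exists>\<^sub>F k in sequentially. \<exists>m. \<eta> \<le> \<bar>T (u k) m\<bar>"
    by (auto simp: Tu)
  obtain s :: "nat \<Rightarrow> nat" where s: "strict_mono s" "\<And>k. \<exists>m. \<eta> \<le> \<bar>T (u (s k)) m\<bar>"
    using frequently_subsequence[OF \<eta>(2)] by blast
  \<comment> \<open>The images must meet the error budget of \<open>near_block_left_inverse\<close>.
    For the vectors themselves any finite budget makes synthesis bounded, and 1 is taken.\<close>
  define c where "c = (\<eta>/2) powr p"
  have tol: "0 < block_tol p 1 k" "0 < block_tol p c k" for k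
    using \<eta>(1) by (auto intro!: block_tol_pos simp: c_def)
  have null: "(\<lambda>k. u (s k) i) \<longlonglongrightarrow> 0" "(\<lambda>k. T (u (s k)) i) \<longlonglongrightarrow> 0" for i
    using LIMSEQ_subseq_LIMSEQ[OF u(2) s(1)] LIMSEQ_subseq_LIMSEQ[OF u(4) s(1)]
    by (simp_all add: o_def)
  define P where "P k r a \<longleftrightarrow> mod_le w p (restr {a..} (u (s r))) (block_tol p 1 k) \<and>
      mod_le w p (restr {a..} (T (u (s r)))) (block_tol p c k)" for k r a
  define Q where "Q k a r \<longleftrightarrow> mod_le w p (restr {..<a} (u (s r))) (block_tol p 1 k) \<and>
      mod_le w p (restr {..<a} (T (u (s r)))) (block_tol p c k)" for k a r
  have "\<forall>\<^sub>F a in sequentially. P k r a" for k r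
    unfolding P_def
    by (intro eventually_conj eventually_mod_le_tail[OF u(1) tol(1)]
          eventually_mod_le_tail[OF C(2)[OF u(1)] tol(2)])
  moreover have "\<forall>\<^sub>F r in sequentially. Q k a r" for k a
    unfolding Q_def
    by (intro eventually_conj eventually_mod_le_head[OF null(1) tol(1)]
          eventually_mod_le_head[OF null(2) tol(2)])
  ultimately obtain r a :: "nat \<Rightarrow> nat" where ra: "strict_mono r" "strict_mono a"
    "\<And>k. Q k (a k) (r k)" "\<And>k. P k (r k) (a (Suc k))"
    using alternating_choice[of P Q] by blast
  have "near_blocks w p a (\<lambda>k. u (s (r k))) 1"
    using ra(3,4) by (intro near_blocksI) (auto simp: P_def Q_def)
  moreover have "near_blocks w p a (\<lambda>k. T (u (s (r k)))) ((\<eta>/2) powr p)"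
    using ra(3,4) by (intro near_blocksI) (auto simp: P_def Q_def c_def)
  ultimately show ?thesis
    using near_block_left_inverse[OF T_op ra(2) _ u(1) _ \<eta>(1) s(2)] that by blast
qed

end

theorem theorem4p11:
  fixes w :: "nat \<Rightarrow> real" and p :: real
    and T :: "(nat \<Rightarrow> real) \<Rightarrow> (nat \<Rightarrow> real)"
  assumes "1 \<le> p"
    and "w 0 = 1" and "\<And>n. w n > 0" and "antimono w" and "w \<longlonglongrightarrow> 0"
    and "\<not> summable w"
    and "T \<in> Jj w p"
    and "\<not> compact_op_d w p T"
  shows "Jj w p \<subseteq> JT w p T"
proof
  interpret lorentz_weight w p
    using assms(1-6) by unfold_locales (auto intro: less_imp_le)
  obtain U R where U: "mod_op (\<lambda>_. 1) w p U" and R: "mod_op w w p R"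
    and RTU: "\<And>\<alpha>. \<alpha> \<in> mod_space (\<lambda>_. 1) p \<Longrightarrow> R (T (U \<alpha>)) = \<alpha>"
    using noncompact_left_inverse[OF assms(5,7,8)] by blast
  fix S assume "S \<in> Jj w p"
  then obtain A B where A: "mod_op w w p A" and B: "mod_op w (\<lambda>_. 1) p B"
    and S: "\<And>x. x \<in> lorentz_space w p \<Longrightarrow> S x = A (B x)"
    by (auto simp: Jj_def Lop_d_iff Lop_d_lp_iff)
  show "S \<in> JT w p T"
    unfolding JT_def
  \<comment> \<open>The witnesses left schematic here become \<open>m = 1\<close> with constant
    families.\<close>
  proof (intro CollectI exI conjI ballI allI impI)
    show "(\<lambda>x. A (R x)) \<in> Lop_d w p" "(\<lambda>x. U (B x)) \<in> Lop_d w p"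
      unfolding Lop_d_iff by (rule mod_op_comp[OF R A], rule mod_op_comp[OF B U])
  next
    fix x assume "x \<in> lorentz_space w p"
    hence "R (T (U (B x))) = B x"
      by (intro RTU mod_op_mem[OF B]) (simp add: lorentz_space_eq)
    thus "S x = (\<lambda>n. \<Sum>i<1::nat. A (R (T (U (B x)))) n)"
      using S[OF \<open>x \<in> lorentz_space w p\<close>] by simp
  qed
qed

end
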